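(* Let $G$ be a finite group and $H\leq G$ a subgroup. Let $(\rho_1,V_1)$ and $(\rho_2,V_2)$ be two irreducible $G$-representations and let $(\theta,W)$ be an $H$-representation. Let $\eta$ be the permutation representation of $G\times G\times H$ on $L(G\times G)$ given by $[\eta(g_1,g_2,h)f](g_3,g_4)=f(g_1^{-1}g_3g_2,\,g_2^{-1}g_4h)$. Then the map $$\mathrm{Hom}_{G\times G\times H}(\rho_1\boxtimes \rho_2\boxtimes \theta,\eta)\longrightarrow\mathrm{Hom}_H\left(\mathrm{Res}^G_H(\rho_1\otimes\rho_2),\theta'\right),\qquad T\longmapsto\widetilde{T},$$ where $$\left[\widetilde{T}(v_1\otimes v_2)\right](w)=\frac{|G|}{\sqrt{d_\theta}}\,[T(v_1\otimes v_2\otimes w)](1_G,1_G)$$ for all $v_1\in V_1$, $v_2\in V_2$ and $w\in W$, is an isometric isomorphism of vector spaces. Its inverse is given by the map $$\mathrm{Hom}_H\left(\mathrm{Res}^G_H(\rho_1\otimes\rho_2),\theta'\right)\longrightarrow\mathrm{Hom}_{G\times G\times H}(\rho_1\boxtimes \rho_2\boxtimes \theta,\eta),\qquad S\longmapsto\widehat{S},$$ where $$\left[\widehat{S}(v_1\otimes v_2\otimes w)\right](g_1,g_2)=\frac{\sqrt{d_\theta}}{|G|}\left\{S[\rho_1(g_2^{-1}g_1^{-1})v_1\otimes \rho_2(g_2^{-1})v_2]\right\}(w)$$ for all $v_1\in V_1$, $v_2\in V_2$, $w\in W$ and $g_1,g_2\in G$.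
   Context: All vector spaces are finite-dimensional complex inner product spaces (scalar products linear in the first argument) and all representations are unitary, on nonzero spaces. $d_\theta=\dim W$. $\rho_1\boxtimes\rho_2\boxtimes\theta$ is the outer tensor product, a representation of $G\times G\times H$ on $V_1\otimes V_2\otimes W$; $\rho_1\otimes\rho_2$ is the inner tensor product $g\mapsto\rho_1(g)\otimes\rho_2(g)$ of $G$ on $V_1\otimes V_2$; tensor products carry the usual tensor product scalar product. $\theta'$ is the conjugate (contragredient) representation of $H$ on the dual space $W'=\mathrm{Hom}(W,\mathbb{C})$: $[\theta'(h)\varphi](w)=\varphi(\theta(h^{-1})w)$. For representations $\sigma,\rho$ of a group $\Gamma$, $\mathrm{Hom}_\Gamma(\sigma,\rho)$ is the space of linear maps $T$ between the representation spaces with $T\sigma(g)=\rho(g)T$ for all $g\in\Gamma$. $L(G\times G)$ is the space of all functions $G\times G\to\mathbb{C}$ with scalar product $\langle f_1,f_2\rangle=\sum_{x\in G\times G}f_1(x)\overline{f_2(x)}$. The dual $W'$ has the scalar product $\langle\varphi,\psi\rangle_{W'}=\sum_{\ell}\varphi(w_\ell)\overline{\psi(w_\ell)}$, for any orthonormal basis $(w_\ell)$ of $W$. The spaces of linear maps $\mathrm{Hom}(V,U)$, and hence their subspaces of intertwining operators, are equipped with the normalized Hilbert–Schmidt scalar product $\langle T_1,T_2\rangle_{\mathrm{Hom}(V,U)}=\frac{1}{\dim V}\mathrm{tr}(T_2^*T_1)$; "isometric" refers to these scalar products. *)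

theory Defs
  imports "Jordan_Normal_Form.VS_Connect" "HOL-Algebra.Group_Action"
begin

section \<open>Finite-dimensional complex inner product spaces\<close>

text \<open>
  Spaces are vector spaces over the field of complex numbers in the sense of the locale
  \<^locale>\<open>vectorspace\<close>, together with a scalar product. The fields \<^const>\<open>mult\<close> and
  \<^const>\<open>one\<close> inherited from the record of rings play no role for modules and are left
  undefined in the constructions below. Elements of function spaces are represented by functions
  that are \<^const>\<open>extensional\<close>, so that equality is equality on the domain.
\<close>

abbreviation CC :: "complex ring" where
  "CC \<equiv> class_ring"

record 'v ip_space = "(complex, 'v) module" +
  cinner :: "'v \<Rightarrow> 'v \<Rightarrow> complex"

locale fd_inner_space = vectorspace CC V
  for V :: "'v ip_space" (structure) +
  assumes finite_dim: "vectorspace.fin_dim CC V"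
    and cinner_add_left:
      "\<lbrakk>x \<in> carrier V; y \<in> carrier V; z \<in> carrier V\<rbrakk>
        \<Longrightarrow> cinner V (x \<oplus> y) z = cinner V x z + cinner V y z"
    and cinner_smult_left:
      "\<lbrakk>x \<in> carrier V; y \<in> carrier V\<rbrakk> \<Longrightarrow> cinner V (a \<odot> x) y = a * cinner V x y"
    and cinner_commute:
      "\<lbrakk>x \<in> carrier V; y \<in> carrier V\<rbrakk> \<Longrightarrow> cinner V y x = cnj (cinner V x y)"
    and cinner_pos: "\<lbrakk>x \<in> carrier V; x \<noteq> \<zero>\<rbrakk> \<Longrightarrow> 0 < Re (cinner V x x)"

definition cdim :: "'v ip_space \<Rightarrow> nat" where
  "cdim V = vectorspace.dim CC V"

definition orthonormal_basis :: "'v ip_space \<Rightarrow> 'v set \<Rightarrow> bool" where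
  "orthonormal_basis V E \<longleftrightarrow>
     vectorspace.basis CC V E \<and>
     (\<forall>x\<in>E. \<forall>y\<in>E. cinner V x y = (if x = y then 1 else 0))"

section \<open>Linear maps\<close>

definition lin_maps :: "'v ip_space \<Rightarrow> 'u ip_space \<Rightarrow> ('v \<Rightarrow> 'u) set" where
  "lin_maps V U = LinearCombinations.module_hom CC V U \<inter> extensional (carrier V)"

definition adjoint :: "'v ip_space \<Rightarrow> 'u ip_space \<Rightarrow> ('v \<Rightarrow> 'u) \<Rightarrow> 'u \<Rightarrow> 'v" where
  "adjoint V U T =
     (THE S. S \<in> lin_maps U V \<and>
       (\<forall>v\<in>carrier V. \<forall>u\<in>carrier U. cinner U (T v) u = cinner V v (S u)))"

text \<open>
  The trace of the matrix \<open>(M v u)\<close> of an endomorphism \<open>A\<close> with respect to a basis \<open>B\<close>; its value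
  is independent of the choice of basis.
\<close>

definition lin_trace :: "'v ip_space \<Rightarrow> ('v \<Rightarrow> 'v) \<Rightarrow> complex" where
  "lin_trace V A =
     (THE t. \<exists>B M. finite B \<and> vectorspace.basis CC V B \<and>
        (\<forall>v\<in>B. A v = LinearCombinations.module.lincomb V (M v) B) \<and> t = (\<Sum>v\<in>B. M v v))"

text \<open>The space of linear maps with the normalized Hilbert--Schmidt scalar product.\<close>

definition hom_space :: "'v ip_space \<Rightarrow> 'u ip_space \<Rightarrow> ('v \<Rightarrow> 'u) ip_space" where
  "hom_space V U =
     \<lparr>carrier = lin_maps V U,
      mult = undefined, one = undefined,
      zero = (\<lambda>v\<in>carrier V. \<zero>\<^bsub>U\<^esub>),
      add = (\<lambda>S T. \<lambda>v\<in>carrier V. S v \<oplus>\<^bsub>U\<^esub> T v),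
      smult = (\<lambda>a T. \<lambda>v\<in>carrier V. a \<odot>\<^bsub>U\<^esub> T v),
      cinner = (\<lambda>T\<^sub>1 T\<^sub>2. lin_trace V (compose (carrier V) (adjoint V U T\<^sub>2) T\<^sub>1) / of_nat (cdim V))\<rparr>"

definition isometric_iso :: "'v ip_space \<Rightarrow> 'u ip_space \<Rightarrow> ('v \<Rightarrow> 'u) \<Rightarrow> bool" where
  "isometric_iso V U \<Phi> \<longleftrightarrow>
     \<Phi> \<in> LinearCombinations.module_hom CC V U \<and> bij_betw \<Phi> (carrier V) (carrier U) \<and>
     (\<forall>x\<in>carrier V. \<forall>y\<in>carrier V. cinner U (\<Phi> x) (\<Phi> y) = cinner V x y)"

section \<open>Function spaces, dual spaces, tensor products\<close>

definition function_space :: "'x set \<Rightarrow> ('x \<Rightarrow> complex) ip_space" where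
  "function_space X =
     \<lparr>carrier = X \<rightarrow>\<^sub>E UNIV,
      mult = undefined, one = undefined,
      zero = (\<lambda>x\<in>X. 0),
      add = (\<lambda>f g. \<lambda>x\<in>X. f x + g x),
      smult = (\<lambda>a f. \<lambda>x\<in>X. a * f x),
      cinner = (\<lambda>f g. \<Sum>x\<in>X. f x * cnj (g x))\<rparr>"

text \<open>The scalar product of the dual does not depend on the orthonormal basis \<open>E\<close>.\<close>

definition dual_space :: "'w ip_space \<Rightarrow> ('w \<Rightarrow> complex) ip_space" where
  "dual_space W =
     \<lparr>carrier = {\<phi> \<in> extensional (carrier W).
        (\<forall>x\<in>carrier W. \<forall>y\<in>carrier W. \<phi> (x \<oplus>\<^bsub>W\<^esub> y) = \<phi> x + \<phi> y) \<and>
        (\<forall>a. \<forall>x\<in>carrier W. \<phi> (a \<odot>\<^bsub>W\<^esub> x) = a * \<phi> x)},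
      mult = undefined, one = undefined,
      zero = (\<lambda>w\<in>carrier W. 0),
      add = (\<lambda>\<phi> \<psi>. \<lambda>w\<in>carrier W. \<phi> w + \<psi> w),
      smult = (\<lambda>a \<phi>. \<lambda>w\<in>carrier W. a * \<phi> w),
      cinner = (\<lambda>\<phi> \<psi>. THE s. \<exists>E. orthonormal_basis W E \<and> s = (\<Sum>w\<in>E. \<phi> w * cnj (\<psi> w)))\<rparr>"

text \<open>
  The tensor product of two finite-dimensional inner product spaces \<open>V\<close>, \<open>W\<close> is realized as the
  space of all maps \<open>V \<times> W \<rightarrow> \<complex>\<close> that are antilinear in each variable, where \<open>v \<otimes> w\<close> is the map
  \<open>(v', w') \<mapsto> \<langle>v, v'\<rangle> \<langle>w, w'\<rangle>\<close>. As scalar products are linear in the first argument, \<open>v \<otimes> w\<close> is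
  bilinear in \<open>v\<close> and \<open>w\<close>; if \<open>E\<close> and \<open>F\<close> are orthonormal bases of \<open>V\<close> and \<open>W\<close>, then the
  \<open>e \<otimes> f\<close> form a basis, because the coefficient of \<open>e \<otimes> f\<close> in \<open>B\<close> is \<open>B (e, f)\<close>. The scalar product
  below is the one for which this basis is orthonormal, so that
  \<open>\<langle>v \<otimes> w, v' \<otimes> w'\<rangle> = \<langle>v, v'\<rangle> \<langle>w, w'\<rangle>\<close>; it does not depend on \<open>E\<close> and \<open>F\<close>. Threefold tensor products
  are nested to the right, in accordance with the direct product of groups and with tuples.
\<close>

definition tensor :: "'v ip_space \<Rightarrow> 'w ip_space \<Rightarrow> ('v \<times> 'w \<Rightarrow> complex) ip_space"
    (infixr \<open>\<otimes>\<^sub>s\<close> 80) where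
  "V \<otimes>\<^sub>s W =
     \<lparr>carrier = {B \<in> extensional (carrier V \<times> carrier W).
        (\<forall>x\<in>carrier V. \<forall>y\<in>carrier V. \<forall>w\<in>carrier W. B (x \<oplus>\<^bsub>V\<^esub> y, w) = B (x, w) + B (y, w)) \<and>
        (\<forall>a. \<forall>x\<in>carrier V. \<forall>w\<in>carrier W. B (a \<odot>\<^bsub>V\<^esub> x, w) = cnj a * B (x, w)) \<and>
        (\<forall>v\<in>carrier V. \<forall>x\<in>carrier W. \<forall>y\<in>carrier W. B (v, x \<oplus>\<^bsub>W\<^esub> y) = B (v, x) + B (v, y)) \<and>
        (\<forall>a. \<forall>v\<in>carrier V. \<forall>x\<in>carrier W. B (v, a \<odot>\<^bsub>W\<^esub> x) = cnj a * B (v, x))},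
      mult = undefined, one = undefined,
      zero = (\<lambda>p\<in>carrier V \<times> carrier W. 0),
      add = (\<lambda>B C. \<lambda>p\<in>carrier V \<times> carrier W. B p + C p),
      smult = (\<lambda>a B. \<lambda>p\<in>carrier V \<times> carrier W. a * B p),
      cinner = (\<lambda>B C. THE s. \<exists>E F. orthonormal_basis V E \<and> orthonormal_basis W F \<and>
        s = (\<Sum>e\<in>E. \<Sum>f\<in>F. B (e, f) * cnj (C (e, f))))\<rparr>"

definition pure_tensor ::
    "'v ip_space \<Rightarrow> 'w ip_space \<Rightarrow> 'v \<Rightarrow> 'w \<Rightarrow> 'v \<times> 'w \<Rightarrow> complex" where
  "pure_tensor V W v w =
     (\<lambda>(v', w')\<in>carrier V \<times> carrier W. cinner V v v' * cinner W w w')"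

text \<open>The endomorphism \<open>A \<otimes> B\<close> of \<open>V \<otimes> W\<close>.\<close>

definition tensor_map ::
    "'v ip_space \<Rightarrow> 'w ip_space \<Rightarrow> ('v \<Rightarrow> 'v) \<Rightarrow> ('w \<Rightarrow> 'w)
      \<Rightarrow> ('v \<times> 'w \<Rightarrow> complex) \<Rightarrow> ('v \<times> 'w \<Rightarrow> complex)" where
  "tensor_map V W A B =
     (THE T. T \<in> lin_maps (V \<otimes>\<^sub>s W) (V \<otimes>\<^sub>s W) \<and>
       (\<forall>v\<in>carrier V. \<forall>w\<in>carrier W.
          T (pure_tensor V W v w) = pure_tensor V W (A v) (B w)))"

section \<open>Unitary representations\<close>

locale unitary_rep = group_action \<Gamma> "carrier V" \<sigma> + fd_inner_space V
  for \<Gamma> :: "('g, 'm) monoid_scheme" and V :: "'v ip_space" and \<sigma> :: "'g \<Rightarrow> 'v \<Rightarrow> 'v" +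
  assumes nonzero: "carrier V \<noteq> {\<zero>\<^bsub>V\<^esub>}"
    and linear: "g \<in> carrier \<Gamma> \<Longrightarrow> \<sigma> g \<in> lin_maps V V"
    and unitary: "\<lbrakk>g \<in> carrier \<Gamma>; x \<in> carrier V; y \<in> carrier V\<rbrakk>
      \<Longrightarrow> cinner V (\<sigma> g x) (\<sigma> g y) = cinner V x y"

locale irreducible_rep = unitary_rep +
  assumes irreducible:
    "\<lbrakk>VectorSpace.subspace CC U V; \<And>g. g \<in> carrier \<Gamma> \<Longrightarrow> \<sigma> g ` U \<subseteq> U\<rbrakk>
      \<Longrightarrow> U = {\<zero>\<^bsub>V\<^esub>} \<or> U = carrier V"

text \<open>
  \<open>intertwiners \<Gamma> V \<sigma> U \<rho>\<close> is \<open>Hom\<^sub>\<Gamma>(\<sigma>, \<rho>)\<close> as a subspace of \<^term>\<open>hom_space V U\<close>. For a subgroup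
  \<open>H\<close>, the group structure is \<open>\<Gamma>\<lparr>carrier := H\<rparr>\<close>; as only the values of \<open>\<sigma>\<close> and \<open>\<rho>\<close> on the
  carrier of the group matter, the restriction to \<open>H\<close> of a representation of \<open>\<Gamma>\<close> is given by the
  same function.
\<close>

definition intertwiners ::
    "('g, 'm) monoid_scheme \<Rightarrow> 'v ip_space \<Rightarrow> ('g \<Rightarrow> 'v \<Rightarrow> 'v) \<Rightarrow> 'u ip_space \<Rightarrow> ('g \<Rightarrow> 'u \<Rightarrow> 'u)
      \<Rightarrow> ('v \<Rightarrow> 'u) ip_space" where
  "intertwiners \<Gamma> V \<sigma> U \<rho> =
     (hom_space V U)\<lparr>carrier :=
       {T \<in> lin_maps V U. \<forall>g\<in>carrier \<Gamma>. \<forall>v\<in>carrier V. T (\<sigma> g v) = \<rho> g (T v)}\<rparr>"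

definition inner_tensor_rep ::
    "'v ip_space \<Rightarrow> 'w ip_space \<Rightarrow> ('g \<Rightarrow> 'v \<Rightarrow> 'v) \<Rightarrow> ('g \<Rightarrow> 'w \<Rightarrow> 'w)
      \<Rightarrow> 'g \<Rightarrow> ('v \<times> 'w \<Rightarrow> complex) \<Rightarrow> ('v \<times> 'w \<Rightarrow> complex)" where
  "inner_tensor_rep V W \<sigma> \<rho> = (\<lambda>g. tensor_map V W (\<sigma> g) (\<rho> g))"

definition outer_tensor_rep ::
    "'v ip_space \<Rightarrow> 'w ip_space \<Rightarrow> ('g \<Rightarrow> 'v \<Rightarrow> 'v) \<Rightarrow> ('h \<Rightarrow> 'w \<Rightarrow> 'w)
      \<Rightarrow> 'g \<times> 'h \<Rightarrow> ('v \<times> 'w \<Rightarrow> complex) \<Rightarrow> ('v \<times> 'w \<Rightarrow> complex)" where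
  "outer_tensor_rep V W \<sigma> \<rho> = (\<lambda>(g, h). tensor_map V W (\<sigma> g) (\<rho> h))"

definition conjugate_rep ::
    "('g, 'm) monoid_scheme \<Rightarrow> 'w ip_space \<Rightarrow> ('g \<Rightarrow> 'w \<Rightarrow> 'w)
      \<Rightarrow> 'g \<Rightarrow> ('w \<Rightarrow> complex) \<Rightarrow> ('w \<Rightarrow> complex)" where
  "conjugate_rep \<Gamma> W \<theta> =
     (\<lambda>h. \<lambda>\<phi>\<in>carrier (dual_space W). \<lambda>w\<in>carrier W. \<phi> (\<theta> (inv\<^bsub>\<Gamma>\<^esub> h) w))"

definition eta ::
    "('g, 'm) monoid_scheme \<Rightarrow> 'g \<times> 'g \<times> 'g \<Rightarrow> ('g \<times> 'g \<Rightarrow> complex) \<Rightarrow> ('g \<times> 'g \<Rightarrow> complex)" where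
  "eta G =
     (\<lambda>(g\<^sub>1, g\<^sub>2, h). \<lambda>f\<in>carrier (function_space (carrier G \<times> carrier G)).
        \<lambda>(g\<^sub>3, g\<^sub>4)\<in>carrier G \<times> carrier G.
          f (inv\<^bsub>G\<^esub> g\<^sub>1 \<otimes>\<^bsub>G\<^esub> g\<^sub>3 \<otimes>\<^bsub>G\<^esub> g\<^sub>2, inv\<^bsub>G\<^esub> g\<^sub>2 \<otimes>\<^bsub>G\<^esub> g\<^sub>4 \<otimes>\<^bsub>G\<^esub> h))"

section \<open>The two maps\<close>

text \<open>
  \<open>tilde\<close> and \<open>hat\<close> are given by their values on pure tensors; the theorem includes the claim that
  exactly one linear map has these values.
\<close>

definition tilde_spec ::
    "('g, 'm) monoid_scheme \<Rightarrow> 'a ip_space \<Rightarrow> 'b ip_space \<Rightarrow> 'w ip_space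
      \<Rightarrow> (('a \<times> ('b \<times> 'w \<Rightarrow> complex) \<Rightarrow> complex) \<Rightarrow> 'g \<times> 'g \<Rightarrow> complex)
      \<Rightarrow> (('a \<times> 'b \<Rightarrow> complex) \<Rightarrow> 'w \<Rightarrow> complex) \<Rightarrow> bool" where
  "tilde_spec G V\<^sub>1 V\<^sub>2 W T S \<longleftrightarrow>
     S \<in> lin_maps (V\<^sub>1 \<otimes>\<^sub>s V\<^sub>2) (dual_space W) \<and>
     (\<forall>v\<^sub>1\<in>carrier V\<^sub>1. \<forall>v\<^sub>2\<in>carrier V\<^sub>2. \<forall>w\<in>carrier W.
        S (pure_tensor V\<^sub>1 V\<^sub>2 v\<^sub>1 v\<^sub>2) w =
          complex_of_real (real (card (carrier G)) / sqrt (real (cdim W))) *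
          T (pure_tensor V\<^sub>1 (V\<^sub>2 \<otimes>\<^sub>s W) v\<^sub>1 (pure_tensor V\<^sub>2 W v\<^sub>2 w)) (\<one>\<^bsub>G\<^esub>, \<one>\<^bsub>G\<^esub>))"

definition tilde where
  "tilde G V\<^sub>1 V\<^sub>2 W T = (THE S. tilde_spec G V\<^sub>1 V\<^sub>2 W T S)"

definition hat_spec ::
    "('g, 'm) monoid_scheme \<Rightarrow> 'a ip_space \<Rightarrow> ('g \<Rightarrow> 'a \<Rightarrow> 'a) \<Rightarrow> 'b ip_space \<Rightarrow> ('g \<Rightarrow> 'b \<Rightarrow> 'b)
      \<Rightarrow> 'w ip_space
      \<Rightarrow> (('a \<times> 'b \<Rightarrow> complex) \<Rightarrow> 'w \<Rightarrow> complex)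
      \<Rightarrow> (('a \<times> ('b \<times> 'w \<Rightarrow> complex) \<Rightarrow> complex) \<Rightarrow> 'g \<times> 'g \<Rightarrow> complex) \<Rightarrow> bool" where
  "hat_spec G V\<^sub>1 \<rho>\<^sub>1 V\<^sub>2 \<rho>\<^sub>2 W S T \<longleftrightarrow>
     T \<in> lin_maps (V\<^sub>1 \<otimes>\<^sub>s V\<^sub>2 \<otimes>\<^sub>s W) (function_space (carrier G \<times> carrier G)) \<and>
     (\<forall>v\<^sub>1\<in>carrier V\<^sub>1. \<forall>v\<^sub>2\<in>carrier V\<^sub>2. \<forall>w\<in>carrier W. \<forall>g\<^sub>1\<in>carrier G. \<forall>g\<^sub>2\<in>carrier G.
        T (pure_tensor V\<^sub>1 (V\<^sub>2 \<otimes>\<^sub>s W) v\<^sub>1 (pure_tensor V\<^sub>2 W v\<^sub>2 w)) (g\<^sub>1, g\<^sub>2) =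
          complex_of_real (sqrt (real (cdim W)) / real (card (carrier G))) *
          S (pure_tensor V\<^sub>1 V\<^sub>2 (\<rho>\<^sub>1 (inv\<^bsub>G\<^esub> g\<^sub>2 \<otimes>\<^bsub>G\<^esub> inv\<^bsub>G\<^esub> g\<^sub>1) v\<^sub>1) (\<rho>\<^sub>2 (inv\<^bsub>G\<^esub> g\<^sub>2) v\<^sub>2)) w)"

definition hat where
  "hat G V\<^sub>1 \<rho>\<^sub>1 V\<^sub>2 \<rho>\<^sub>2 W S = (THE T. hat_spec G V\<^sub>1 \<rho>\<^sub>1 V\<^sub>2 \<rho>\<^sub>2 W S T)"

end

theory Submission
  imports Defs
begin

text \<open>
  The group \<open>G \<times> G \<times> H\<close> acts on the set \<open>G \<times> G\<close> by
  \<open>(g\<^sub>1, g\<^sub>2, h) (x, y) = (g\<^sub>1 x g\<^sub>2\<^bsup>-1\<^esup>, g\<^sub>2 y h\<^bsup>-1\<^esup>)\<close>, and \<open>\<eta>\<close> is the corresponding permutation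
  representation. The action is transitive, and the stabilizer of \<open>(1, 1)\<close> is the diagonal copy
  \<open>{(h, h, h) | h \<in> H}\<close> of \<open>H\<close>. The theorem is Frobenius reciprocity for this action: an
  intertwiner \<open>T\<close> into \<open>L(G \<times> G)\<close> is determined by the form \<open>v \<mapsto> (T v)(1, 1)\<close>, because
  the value at any other point is the value at \<open>(1, 1)\<close> on a translated vector (\<open>value_by_translation\<close>), and the
  forms that arise are those invariant under the stabilizer. A form on \<open>V\<^sub>1 \<otimes> V\<^sub>2 \<otimes> W\<close> is
  the same as a linear map \<open>V\<^sub>1 \<otimes> V\<^sub>2 \<rightarrow> W'\<close>, and invariance under the diagonal \<open>H\<close>
  becomes the intertwining property of that map (\<open>tilde_intertwines\<close>, \<open>hat_intertwines\<close>). The formula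
  for \<open>hat\<close> rebuilds all values of \<open>T\<close> from those at \<open>(1, 1)\<close>, so the two maps are mutually inverse.
  
  For the isometry, both scalar products are expressed by values on the vectors \<open>e \<otimes> f \<otimes> k\<close> with
  \<open>e\<close>, \<open>f\<close>, \<open>k\<close> in orthonormal bases. The scalar product of \<open>L(G \<times> G)\<close> contributes one
  summand for every point of \<open>G \<times> G\<close>. By the translation formula the summand at \<open>(g\<^sub>1, g\<^sub>2)\<close> is
  the one at \<open>(1, 1)\<close> computed in another orthonormal basis, and such a sum does not depend on the basis
  (\<open>sum_orthonormal_basis_independent\<close>). Hence all \<open>|G|\<^sup>2\<close> summands agree (\<open>cinner_X\<close>), and
  the factor \<open>|G| / \<surd>d\<^sub>\<theta>\<close> balances this multiplicity against the normalizations by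
  \<open>d\<^sub>1 d\<^sub>2 d\<^sub>\<theta>\<close> and \<open>d\<^sub>1 d\<^sub>2\<close>.
  
  The linear algebra behind this is based on one principle: identities between vectors are tested by scalar
  products, so that calculations take place in the complex numbers. It yields orthonormal bases, the Riesz
  representation, adjoints, the trace, and a criterion (\<open>pointwise_inner_space\<close>) under which a space of
  functions with pointwise operations is an inner product space with an explicit orthonormal basis; function
  spaces, duals and tensor products are all instances.
\<close>

section \<open>Inner product spaces and linear forms\<close>

lemma lin_mapsI:
  assumes "T \<in> extensional (carrier V)"
    and "\<And>x. x \<in> carrier V \<Longrightarrow> T x \<in> carrier U"
    and "\<And>x y. x \<in> carrier V \<Longrightarrow> y \<in> carrier V \<Longrightarrow> T (x \<oplus>\<^bsub>V\<^esub> y) = T x \<oplus>\<^bsub>U\<^esub> T y"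
    and "\<And>a x. x \<in> carrier V \<Longrightarrow> T (a \<odot>\<^bsub>V\<^esub> x) = a \<odot>\<^bsub>U\<^esub> T x"
  shows "T \<in> lin_maps V U"
  using assms by (auto simp: lin_maps_def LinearCombinations.module_hom_def)

lemma lin_mapsD:
  assumes "T \<in> lin_maps V U"
  shows "T \<in> extensional (carrier V)"
    and "x \<in> carrier V \<Longrightarrow> T x \<in> carrier U"
    and "x \<in> carrier V \<Longrightarrow> y \<in> carrier V \<Longrightarrow> T (x \<oplus>\<^bsub>V\<^esub> y) = T x \<oplus>\<^bsub>U\<^esub> T y"
    and "x \<in> carrier V \<Longrightarrow> T (a \<odot>\<^bsub>V\<^esub> x) = a \<odot>\<^bsub>U\<^esub> T x"
  using assms by (auto simp: lin_maps_def LinearCombinations.module_hom_def)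

text \<open>
  Membership in the carrier of \<^term>\<open>dual_space V\<close> up to extensionality, so that arbitrary lambda
  expressions can be linear forms.
\<close>
definition linear_form :: "'v ip_space \<Rightarrow> ('v \<Rightarrow> complex) \<Rightarrow> bool" where
  "linear_form V \<phi> \<longleftrightarrow>
     (\<forall>x\<in>carrier V. \<forall>y\<in>carrier V. \<phi> (x \<oplus>\<^bsub>V\<^esub> y) = \<phi> x + \<phi> y) \<and>
     (\<forall>a. \<forall>x\<in>carrier V. \<phi> (a \<odot>\<^bsub>V\<^esub> x) = a * \<phi> x)"

lemma linear_formI:
  assumes "\<And>x y. x \<in> carrier V \<Longrightarrow> y \<in> carrier V \<Longrightarrow> \<phi> (x \<oplus>\<^bsub>V\<^esub> y) = \<phi> x + \<phi> y"
    and "\<And>a x. x \<in> carrier V \<Longrightarrow> \<phi> (a \<odot>\<^bsub>V\<^esub> x) = a * \<phi> x"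
  shows "linear_form V \<phi>"
  using assms by (auto simp: linear_form_def)

lemma linear_form_add:
  "\<lbrakk>linear_form V \<phi>; x \<in> carrier V; y \<in> carrier V\<rbrakk> \<Longrightarrow> \<phi> (x \<oplus>\<^bsub>V\<^esub> y) = \<phi> x + \<phi> y"
  by (auto simp: linear_form_def)

lemma linear_form_smult:
  "\<lbrakk>linear_form V \<phi>; x \<in> carrier V\<rbrakk> \<Longrightarrow> \<phi> (a \<odot>\<^bsub>V\<^esub> x) = a * \<phi> x"
  by (auto simp: linear_form_def)

lemma linear_form_compose:
  assumes "linear_form U \<phi>" and "T \<in> lin_maps V U"
  shows "linear_form V (\<lambda>x. \<phi> (T x))"
  by (intro linear_formI) (simp_all add: lin_mapsD[OF assms(2)] linear_form_add[OF assms(1)] linear_form_smult[OF assms(1)])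

text \<open>
  Finite dimension is left out, because for the spaces constructed below it is a consequence: the scalar product
  axioms are verified first, and then a finite total orthonormal set is exhibited.
\<close>
locale inner_space = vectorspace CC V
  for V :: "'v ip_space" (structure) +
  assumes cinner_add_left:
      "\<lbrakk>x \<in> carrier V; y \<in> carrier V; z \<in> carrier V\<rbrakk>
        \<Longrightarrow> cinner V (x \<oplus> y) z = cinner V x z + cinner V y z"
    and cinner_smult_left:
      "\<lbrakk>x \<in> carrier V; y \<in> carrier V\<rbrakk> \<Longrightarrow> cinner V (a \<odot> x) y = a * cinner V x y"
    and cinner_commute:
      "\<lbrakk>x \<in> carrier V; y \<in> carrier V\<rbrakk> \<Longrightarrow> cinner V y x = cnj (cinner V x y)"
    and cinner_pos: "\<lbrakk>x \<in> carrier V; x \<noteq> \<zero>\<rbrakk> \<Longrightarrow> 0 < Re (cinner V x x)"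

sublocale fd_inner_space \<subseteq> inner_space
  by unfold_locales
    (rule cinner_add_left cinner_smult_left cinner_commute cinner_pos; assumption)+

context inner_space
begin

lemma cinner_linear_form: "y \<in> carrier V \<Longrightarrow> linear_form V (\<lambda>x. cinner V x y)"
  by (intro linear_formI) (simp_all add: cinner_add_left cinner_smult_left)

lemma cinner_add_right:
  "\<lbrakk>x \<in> carrier V; y \<in> carrier V; z \<in> carrier V\<rbrakk>
    \<Longrightarrow> cinner V z (x \<oplus> y) = cinner V z x + cinner V z y"
  using cinner_commute[of "x \<oplus> y" z] cinner_commute[of x z] cinner_commute[of y z]
  by (simp add: cinner_add_left)

lemma cinner_smult_right:
  "\<lbrakk>x \<in> carrier V; y \<in> carrier V\<rbrakk> \<Longrightarrow> cinner V y (a \<odot> x) = cnj a * cinner V y x"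
  using cinner_commute[of "a \<odot> x" y] cinner_commute[of x y]
  by (simp add: cinner_smult_left)

lemma linear_form_zero: "linear_form V \<phi> \<Longrightarrow> \<phi> \<zero> = 0"
  using linear_form_add[of V \<phi> \<zero> \<zero>] by simp

lemma cinner_zero_left [simp]: "x \<in> carrier V \<Longrightarrow> cinner V \<zero> x = 0"
  using linear_form_zero[OF cinner_linear_form] .

lemma linear_form_minus:
  assumes "linear_form V \<phi>" "x \<in> carrier V" "y \<in> carrier V"
  shows "\<phi> (x \<ominus> y) = \<phi> x - \<phi> y"
proof -
  have "x = (x \<ominus> y) \<oplus> y"
    using assms by (simp add: a_minus_def a_assoc l_neg)
  then have "\<phi> x = \<phi> (x \<ominus> y) + \<phi> y"
    using linear_form_add[OF assms(1), of "x \<ominus> y" y] assms by simp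
  then show ?thesis by simp
qed

lemma eq_zeroI: "\<lbrakk>x \<in> carrier V; cinner V x x = 0\<rbrakk> \<Longrightarrow> x = \<zero>"
  using cinner_pos[of x] by force

text \<open>
  The test by which equations between vectors are reduced to equations between complex numbers.
\<close>
lemma cinner_eqI:
  assumes "x \<in> carrier V" "y \<in> carrier V" "\<And>z. z \<in> carrier V \<Longrightarrow> cinner V x z = cinner V y z"
  shows "x = y"
proof -
  have "cinner V (x \<ominus> y) (x \<ominus> y) = 0"
    using linear_form_minus[OF cinner_linear_form, of "x \<ominus> y" x y] assms by simp
  then have "x \<ominus> y = \<zero>" using assms eq_zeroI by simp
  then show ?thesis using assms by simp
qed

lemma linear_form_lincomb:
  assumes "linear_form V \<phi>" "finite A" "A \<subseteq> carrier V"
  shows "\<phi> (lincomb a A) = (\<Sum>v\<in>A. a v * \<phi> v)"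
  using assms(2,3)
proof (induction A)
  case empty
  then show ?case using linear_form_zero[OF assms(1)] by (simp add: lincomb_def)
next
  case (insert v A)
  have "lincomb a (insert v A) = a v \<odot> v \<oplus> lincomb a A"
    using lincomb_insert[of A a v] insert by simp
  with insert show ?case
    by (simp add: linear_form_add[OF assms(1)] linear_form_smult[OF assms(1)] Pi_def)
qed

definition orthonormal :: "'v set \<Rightarrow> bool" where
  "orthonormal E \<longleftrightarrow> finite E \<and> E \<subseteq> carrier V \<and>
     (\<forall>x\<in>E. \<forall>y\<in>E. cinner V x y = (if x = y then 1 else 0))"

lemma cinner_lincomb_orthonormal:
  assumes "orthonormal E" "e \<in> E"
  shows "cinner V (lincomb a E) e = a e"
proof -
  have "cinner V (lincomb a E) e = (\<Sum>v\<in>E. a v * cinner V v e)"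
    using assms by (intro linear_form_lincomb cinner_linear_form) (auto simp: orthonormal_def)
  also have "\<dots> = (\<Sum>v\<in>E. if v = e then a v else 0)"
    using assms by (intro sum.cong) (auto simp: orthonormal_def)
  finally show ?thesis using assms by (simp add: orthonormal_def)
qed

lemma orthonormal_lin_indpt:
  assumes "orthonormal E"
  shows "lin_indpt E"
proof (rule finite_lin_indpt2)
  show "finite E" "E \<subseteq> carrier V" using assms by (auto simp: orthonormal_def)
  fix a assume "lincomb a E = \<zero>"
  then show "\<forall>v\<in>E. a v = \<zero>\<^bsub>CC\<^esub>"
    using cinner_lincomb_orthonormal[OF assms, of _ a] assms
    by (force simp: orthonormal_def)
qed

text \<open>
  The difference between a vector and its Fourier sum is orthogonal to all of \<open>E\<close>.
\<close>
lemma total_expansion: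
  assumes E: "orthonormal E"
    and total: "\<And>x. \<lbrakk>x \<in> carrier V; \<And>e. e \<in> E \<Longrightarrow> cinner V x e = 0\<rbrakk> \<Longrightarrow> x = \<zero>"
    and x: "x \<in> carrier V"
  shows "x = lincomb (\<lambda>e. cinner V x e) E"
proof -
  let ?y = "lincomb (\<lambda>e. cinner V x e) E"
  have sub: "E \<subseteq> carrier V" using E by (auto simp: orthonormal_def)
  then have y: "?y \<in> carrier V" by auto
  have "x \<ominus> ?y = \<zero>"
  proof (rule total)
    fix e assume "e \<in> E"
    with sub have "e \<in> carrier V" by auto
    with \<open>e \<in> E\<close> show "cinner V (x \<ominus> ?y) e = 0"
      using linear_form_minus[OF cinner_linear_form, of e x ?y] x y
        cinner_lincomb_orthonormal[OF E] by simp
  qed (use x y in simp)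
  then show ?thesis using x y by simp
qed

lemma total_orthonormal_basis:
  assumes E: "orthonormal E"
    and total: "\<And>x. \<lbrakk>x \<in> carrier V; \<And>e. e \<in> E \<Longrightarrow> cinner V x e = 0\<rbrakk> \<Longrightarrow> x = \<zero>"
  shows "orthonormal_basis V E" and "fin_dim"
proof -
  have fin: "finite E" and sub: "E \<subseteq> carrier V" using E by (auto simp: orthonormal_def)
  have "x \<in> span E" if "x \<in> carrier V" for x
    using total_expansion[OF E total that] fin sub finite_span[OF fin sub] by force
  then have gen: "gen_set E" using span_is_subset2[OF sub] by auto
  show "orthonormal_basis V E"
    using E gen sub orthonormal_lin_indpt[OF E]
    by (auto simp: orthonormal_basis_def basis_def orthonormal_def)
  show "fin_dim" using gen fin sub by (auto simp: fin_dim_def)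
qed

end

context fd_inner_space
begin

lemma orthonormal_basis_orthonormal: "orthonormal_basis V E \<Longrightarrow> orthonormal E"
  using fin_dim_li_fin[OF finite_dim]
  by (auto simp: orthonormal_basis_def orthonormal_def basis_def)

lemma orthonormal_basis_finite: "orthonormal_basis V E \<Longrightarrow> finite E"
  using orthonormal_basis_orthonormal by (auto simp: orthonormal_def)

lemma orthonormal_basis_carrier: "\<lbrakk>orthonormal_basis V E; e \<in> E\<rbrakk> \<Longrightarrow> e \<in> carrier V"
  using orthonormal_basis_orthonormal by (auto simp: orthonormal_def)

lemma card_orthonormal_basis: "orthonormal_basis V E \<Longrightarrow> cdim V = card E"
  using dim_basis orthonormal_basis_finite by (auto simp: cdim_def orthonormal_basis_def)

text \<open>
  Orthonormal sets are linearly independent, so their size is bounded by the dimension and there is a maximal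
  one. It is total: a nonzero vector orthogonal to it could be normalized and added.
\<close>
lemma orthonormal_basis_exists: "\<exists>E. orthonormal_basis V E"
proof -
  have bound: "finite E \<and> card E \<le> dim" if "orthonormal E" for E
    using li_le_dim[OF finite_dim _ orthonormal_lin_indpt[OF that]] that
    by (auto simp: orthonormal_def)
  have "orthonormal {}" by (simp add: orthonormal_def)
  from maximal_exists[of orthonormal dim, OF bound this]
  obtain E where E: "orthonormal E" and max: "\<And>F. E \<subseteq> F \<Longrightarrow> orthonormal F \<Longrightarrow> F = E"
    unfolding maximal_def by blast
  have "orthonormal_basis V E"
  proof (rule total_orthonormal_basis(1)[OF E], rule ccontr)
    fix x assume x: "x \<in> carrier V" and orth: "\<And>e. e \<in> E \<Longrightarrow> cinner V x e = 0" and "x \<noteq> \<zero>"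
    define r where "r = Re (cinner V x x)"
    have "r > 0" using cinner_pos x \<open>x \<noteq> \<zero>\<close> by (simp add: r_def)
    have xx: "cinner V x x = of_real r"
      using cinner_commute[OF x x] by (simp add: r_def complex_eq_iff)
    define c where "c = 1 / sqrt r"
    have c: "c * c * r = 1" using \<open>r > 0\<close> by (simp add: c_def)
    define u where "u = complex_of_real c \<odot> x"
    have u: "u \<in> carrier V" using x by (simp add: u_def)
    have "cinner V u u = of_real (c * c * r)"
      using x by (simp add: u_def cinner_smult_left cinner_smult_right xx)
    then have uu: "cinner V u u = 1" by (simp add: c)
    have sub: "E \<subseteq> carrier V" using E by (auto simp: orthonormal_def)
    have ue: "cinner V u e = 0" if "e \<in> E" for e
    proof -
      have "e \<in> carrier V" using sub that by auto
      then show ?thesis using x orth[OF that] by (simp add: u_def cinner_smult_left)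
    qed
    have eu: "cinner V e u = 0" if "e \<in> E" for e
    proof -
      have "e \<in> carrier V" using sub that by auto
      then show ?thesis using cinner_commute[OF u] ue[OF that] by simp
    qed
    have "orthonormal (insert u E)"
      using E u uu ue eu by (auto simp: orthonormal_def)
    from max[OF _ this] have "u \<in> E" by auto
    then show False using ue uu by force
  qed
  then show ?thesis by blast
qed

lemma orthonormal_expansion:
  assumes E: "orthonormal_basis V E" and x: "x \<in> carrier V"
  shows "x = lincomb (\<lambda>e. cinner V x e) E"
proof -
  have sub: "E \<subseteq> carrier V" and fin: "finite E"
    using orthonormal_basis_orthonormal[OF E] by (auto simp: orthonormal_def)
  have "x \<in> span E" using E x by (auto simp: orthonormal_basis_def basis_def)
  then obtain a where a: "x = lincomb a E"
    using finite_in_span[OF fin sub] by auto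
  have "lincomb (\<lambda>e. cinner V x e) E = lincomb a E"
    using sub cinner_lincomb_orthonormal[OF orthonormal_basis_orthonormal[OF E]] a
    by (intro lincomb_cong) auto
  with a show ?thesis by simp
qed

lemma linear_form_expansion:
  assumes "orthonormal_basis V E" "linear_form V \<phi>" "x \<in> carrier V"
  shows "\<phi> x = (\<Sum>e\<in>E. cinner V x e * \<phi> e)"
  using linear_form_lincomb[OF assms(2), of E "\<lambda>e. cinner V x e"]
    orthonormal_expansion[OF assms(1,3)] orthonormal_basis_orthonormal[OF assms(1)]
  by (simp add: orthonormal_def)

text \<open>
  The representing vector is \<open>\<Sum>e\<in>E. cnj (\<phi> e) e\<close>, because scalar products are antilinear in the second
  argument.
\<close>
lemma riesz:
  assumes "linear_form V \<phi>"
  obtains u where "u \<in> carrier V" "\<And>x. x \<in> carrier V \<Longrightarrow> \<phi> x = cinner V x u"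
proof -
  obtain E where E: "orthonormal_basis V E" using orthonormal_basis_exists by blast
  note on = orthonormal_basis_orthonormal[OF E]
  have sub: "E \<subseteq> carrier V" using on by (auto simp: orthonormal_def)
  define u where "u = lincomb (\<lambda>e. cnj (\<phi> e)) E"
  have u: "u \<in> carrier V" using sub by (auto simp: u_def)
  have eu: "cinner V e u = \<phi> e" if "e \<in> E" for e
  proof -
    have "e \<in> carrier V" using sub that by auto
    then show ?thesis
      using cinner_commute[of u e] u cinner_lincomb_orthonormal[OF on that] by (simp add: u_def)
  qed
  show thesis
  proof (rule that[OF u])
    fix x assume x: "x \<in> carrier V"
    show "\<phi> x = cinner V x u"
      using linear_form_expansion[OF E assms x]
        linear_form_expansion[OF E cinner_linear_form[OF u] x] eu by simp
  qed
qed

text \<open>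
  If \<open>u\<close> represents \<open>\<psi>\<close>, then either sum is the expansion of \<open>\<phi> u\<close>. This makes the scalar products of
  dual spaces and tensor products well defined, and it is the reason why unitary translations do not
  change the sums that occur in the isometry.
\<close>
lemma sum_orthonormal_basis_independent:
  assumes E: "orthonormal_basis V E" and F: "orthonormal_basis V F"
    and \<phi>: "linear_form V \<phi>" and \<psi>: "linear_form V \<psi>"
  shows "(\<Sum>e\<in>E. \<phi> e * cnj (\<psi> e)) = (\<Sum>f\<in>F. \<phi> f * cnj (\<psi> f))"
proof -
  obtain u where u: "u \<in> carrier V" "\<And>x. x \<in> carrier V \<Longrightarrow> \<psi> x = cinner V x u"
    using riesz[OF \<psi>] by blast
  have "(\<Sum>e\<in>E. \<phi> e * cnj (\<psi> e)) = \<phi> u" if E: "orthonormal_basis V E" for E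
    using linear_form_expansion[OF E \<phi> u(1)] u(2) cinner_commute[OF _ u(1)]
      orthonormal_basis_carrier[OF E] by (simp add: mult.commute)
  then show ?thesis using E F by simp
qed

lemma orthonormal_basis_totalD:
  assumes "orthonormal_basis V E" "x \<in> carrier V" "\<And>e. e \<in> E \<Longrightarrow> cinner V x e = 0"
  shows "x = \<zero>"
  by (rule eq_zeroI[OF assms(2)],
      subst linear_form_expansion[OF assms(1) cinner_linear_form[OF assms(2)] assms(2)])
    (simp add: assms(3))

lemma linear_form_eqI:
  assumes "orthonormal_basis V E" "linear_form V \<phi>" "linear_form V \<psi>"
    and "\<And>e. e \<in> E \<Longrightarrow> \<phi> e = \<psi> e" "x \<in> carrier V"
  shows "\<phi> x = \<psi> x"
  using linear_form_expansion[OF assms(1,2,5)] linear_form_expansion[OF assms(1,3,5)] assms(4)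
  by simp

end

section \<open>Linear maps, adjoints and traces\<close>


lemma lin_maps_ext:
  assumes "S \<in> lin_maps V U" "T \<in> lin_maps V U" "\<And>x. x \<in> carrier V \<Longrightarrow> S x = T x"
  shows "S = T"
  using lin_mapsD(1)[OF assms(1)] lin_mapsD(1)[OF assms(2)] assms(3) by (rule extensionalityI)

locale inner_space_pair = V: fd_inner_space V + U: fd_inner_space U
  for V :: "'v ip_space" and U :: "'u ip_space"
begin

lemma linear_form_image:
  "\<lbrakk>T \<in> lin_maps V U; u \<in> carrier U\<rbrakk> \<Longrightarrow> linear_form V (\<lambda>x. cinner U (T x) u)"
  using linear_form_compose[OF U.cinner_linear_form] by blast

lemma lin_maps_eqI:
  assumes E: "orthonormal_basis V E" and S: "S \<in> lin_maps V U" and T: "T \<in> lin_maps V U"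
    and eq: "\<And>e. e \<in> E \<Longrightarrow> S e = T e"
  shows "S = T"
proof (rule lin_maps_ext[OF S T])
  fix x assume x: "x \<in> carrier V"
  show "S x = T x"
    using V.linear_form_eqI[OF E linear_form_image[OF S] linear_form_image[OF T] _ x] eq
    by (intro U.cinner_eqI lin_mapsD(2)[OF S x] lin_mapsD(2)[OF T x]) auto
qed

text \<open>
  A form that is linear in \<open>x\<close> and antilinear in \<open>u\<close> is given by a linear map: for each \<open>x\<close>, Riesz
  representation in the variable \<open>u\<close> yields the value \<open>T x\<close>, and the linearity of \<open>T\<close> is read off from the
  form. Both adjoints and the extension of maps from a basis arise in this way.
\<close>
lemma weak_linear_map:
  assumes form: "\<And>u. u \<in> carrier U \<Longrightarrow> linear_form V (\<lambda>x. b x u)"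
    and antiform: "\<And>x. x \<in> carrier V \<Longrightarrow> linear_form U (\<lambda>u. cnj (b x u))"
  obtains T where "T \<in> lin_maps V U"
    "\<And>x u. x \<in> carrier V \<Longrightarrow> u \<in> carrier U \<Longrightarrow> cinner U (T x) u = b x u"
proof -
  have "\<exists>t. t \<in> carrier U \<and> (\<forall>u\<in>carrier U. cinner U t u = b x u)" if x: "x \<in> carrier V" for x
  proof -
    obtain t where "t \<in> carrier U" "\<And>u. u \<in> carrier U \<Longrightarrow> cnj (b x u) = cinner U u t"
      using U.riesz[OF antiform[OF x]] by blast
    then show ?thesis using U.cinner_commute by (metis complex_cnj_cnj)
  qed
  then obtain t where t: "\<And>x. x \<in> carrier V \<Longrightarrow> t x \<in> carrier U"
    and tu: "\<And>x u. x \<in> carrier V \<Longrightarrow> u \<in> carrier U \<Longrightarrow> cinner U (t x) u = b x u"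
    by metis
  show thesis
  proof (rule that)
    show "restrict t (carrier V) \<in> lin_maps V U"
    proof (rule lin_mapsI)
      fix x y assume "x \<in> carrier V" "y \<in> carrier V"
      then show "restrict t (carrier V) (x \<oplus>\<^bsub>V\<^esub> y)
          = restrict t (carrier V) x \<oplus>\<^bsub>U\<^esub> restrict t (carrier V) y"
        by (intro U.cinner_eqI) (simp_all add: t tu U.cinner_add_left linear_form_add[OF form])
    next
      fix a x assume "x \<in> carrier V"
      then show "restrict t (carrier V) (a \<odot>\<^bsub>V\<^esub> x) = a \<odot>\<^bsub>U\<^esub> restrict t (carrier V) x"
        by (intro U.cinner_eqI) (simp_all add: t tu U.cinner_smult_left linear_form_smult[OF form])
    qed (use t in auto)
  qed (use tu in simp)
qed

lemma linear_extension:
  assumes E: "orthonormal_basis V E" and t: "\<And>e. e \<in> E \<Longrightarrow> t e \<in> carrier U"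
  obtains T where "T \<in> lin_maps V U"
    "\<And>x u. x \<in> carrier V \<Longrightarrow> u \<in> carrier U \<Longrightarrow>
        cinner U (T x) u = (\<Sum>e\<in>E. cinner V x e * cinner U (t e) u)"
proof (rule weak_linear_map)
  note Ec = V.orthonormal_basis_carrier[OF E]
  fix u assume "u \<in> carrier U"
  show "linear_form V (\<lambda>x. \<Sum>e\<in>E. cinner V x e * cinner U (t e) u)"
    by (intro linear_formI)
      (simp_all add: Ec V.cinner_add_left V.cinner_smult_left sum.distrib sum_distrib_left algebra_simps)
next
  note Ec = V.orthonormal_basis_carrier[OF E]
  fix x assume "x \<in> carrier V"
  show "linear_form U (\<lambda>u. cnj (\<Sum>e\<in>E. cinner V x e * cinner U (t e) u))"
    by (intro linear_formI)
      (simp_all add: t U.cinner_add_right U.cinner_smult_right sum.distrib sum_distrib_left algebra_simps)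
qed (rule that)

lemma adjoint_ex1:
  assumes T: "T \<in> lin_maps V U"
  shows "\<exists>!S. S \<in> lin_maps U V \<and>
       (\<forall>v\<in>carrier V. \<forall>u\<in>carrier U. cinner U (T v) u = cinner V v (S u))"
proof -
  interpret UV: inner_space_pair U V ..
  have 1: "linear_form U (\<lambda>u. cnj (cinner U (T v) u))" if "v \<in> carrier V" for v
    using that by (intro linear_formI)
      (simp_all add: lin_mapsD(2)[OF T] U.cinner_add_right U.cinner_smult_right)
  have 2: "linear_form V (\<lambda>v. cnj (cnj (cinner U (T v) u)))" if "u \<in> carrier U" for u
    using linear_form_image[OF T that] by simp
  obtain S where S: "S \<in> lin_maps U V"
    "\<And>u v. u \<in> carrier U \<Longrightarrow> v \<in> carrier V \<Longrightarrow> cinner V (S u) v = cnj (cinner U (T v) u)"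
    using UV.weak_linear_map[OF 1 2] by blast
  have adj: "cinner U (T v) u = cinner V v (S u)" if "u \<in> carrier U" "v \<in> carrier V" for u v
    using S(2)[OF that] V.cinner_commute[OF lin_mapsD(2)[OF S(1) that(1)] that(2)] by simp
  show ?thesis
  proof (rule ex1I[of _ S])
    fix R assume R: "R \<in> lin_maps U V \<and>
       (\<forall>v\<in>carrier V. \<forall>u\<in>carrier U. cinner U (T v) u = cinner V v (R u))"
    then have R': "R \<in> lin_maps U V" by blast
    show "R = S"
    proof (rule lin_maps_ext[OF R' S(1)])
      fix u assume u: "u \<in> carrier U"
      show "R u = S u"
      proof (rule V.cinner_eqI)
        fix v assume v: "v \<in> carrier V"
        show "cinner V (R u) v = cinner V (S u) v"
          using R adj[OF u v] u v V.cinner_commute[OF v, of "R u"] V.cinner_commute[OF v, of "S u"]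
            lin_mapsD(2)[OF R' u] lin_mapsD(2)[OF S(1) u] by simp
      qed (use lin_mapsD(2)[OF R' u] lin_mapsD(2)[OF S(1) u] in auto)
    qed
  qed (use S(1) adj in blast)
qed

lemma adjoint:
  assumes "T \<in> lin_maps V U"
  shows "adjoint V U T \<in> lin_maps U V"
    and "\<lbrakk>v \<in> carrier V; u \<in> carrier U\<rbrakk> \<Longrightarrow> cinner U (T v) u = cinner V v (adjoint V U T u)"
  using theI'[OF adjoint_ex1[OF assms]] by (auto simp: adjoint_def)

end

context fd_inner_space
begin

text \<open>
  The dual basis of an arbitrary basis. Since coordinates are unique, they are linear.
\<close>
lemma coordinate_forms:
  assumes B: "basis B" and fin: "finite B"
  obtains c where "\<And>v. v \<in> B \<Longrightarrow> linear_form V (c v)"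
    "\<And>x. x \<in> carrier V \<Longrightarrow> x = lincomb (\<lambda>v. c v x) B"
    "\<And>u v. u \<in> B \<Longrightarrow> v \<in> B \<Longrightarrow> c v u = (if u = v then 1 else 0)"
proof -
  have sub: "B \<subseteq> carrier V" using B by (simp add: basis_def)
  have ex1: "\<exists>!a. a \<in> B \<rightarrow>\<^sub>E UNIV \<and> lincomb a B = x" if "x \<in> carrier V" for x
    using basis_criterion[OF fin sub] B that by simp
  define k where "k x = (THE a. a \<in> B \<rightarrow>\<^sub>E UNIV \<and> lincomb a B = x)" for x
  have k: "lincomb (k x) B = x" if "x \<in> carrier V" for x
    using theI'[OF ex1[OF that]] by (simp add: k_def)
  have uniq: "k x v = a v" if "x \<in> carrier V" "lincomb a B = x" "v \<in> B" for x a v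
  proof -
    have "lincomb (restrict a B) B = x"
      using that sub lincomb_cong[of B B "restrict a B" a] by simp
    then have "restrict a B = k x"
      using the1_equality[OF ex1[OF that(1)], of "restrict a B"] by (simp add: k_def)
    then show ?thesis using that(3) by (metis restrict_apply')
  qed
  show thesis
  proof (rule that[of "\<lambda>v x. k x v"])
    fix v assume v: "v \<in> B"
    show "linear_form V (\<lambda>x. k x v)"
    proof (rule linear_formI)
      fix x y assume xy: "x \<in> carrier V" "y \<in> carrier V"
      then have "lincomb (\<lambda>v. k x v + k y v) B = x \<oplus> y"
        using lincomb_sum[OF fin sub, of "k x" "k y"] k by simp
      then show "k (x \<oplus> y) v = k x v + k y v" using uniq[OF _ _ v] xy by simp
    next
      fix a x assume x: "x \<in> carrier V"
      then have "lincomb (\<lambda>v. a * k x v) B = a \<odot> x"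
        using lincomb_smult[OF sub, of "k x" a] k by simp
      then show "k (a \<odot> x) v = a * k x v" using uniq[OF _ _ v] x by simp
    qed
  next
    fix x assume "x \<in> carrier V"
    then show "x = lincomb (\<lambda>v. k x v) B" using k by simp
  next
    fix u v assume u: "u \<in> B" and v: "v \<in> B"
    have uV: "u \<in> carrier V" using u sub by auto
    have "lincomb (\<lambda>w. if w = u then 1 else 0) B = u"
    proof (rule cinner_eqI)
      fix z assume z: "z \<in> carrier V"
      have "cinner V (lincomb (\<lambda>w. if w = u then 1 else 0) B) z
          = (\<Sum>w\<in>B. (if w = u then 1 else 0) * cinner V w z)"
        by (rule linear_form_lincomb[OF cinner_linear_form[OF z] fin sub])
      also have "\<dots> = (\<Sum>w\<in>B. if w = u then cinner V w z else 0)"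
        by (intro sum.cong) auto
      also have "\<dots> = cinner V u z" using u fin by simp
      finally show "cinner V (lincomb (\<lambda>w. if w = u then 1 else 0) B) z = cinner V u z" .
    qed (use sub uV in auto)
    then show "k u v = (if u = v then 1 else 0)" using uniq[OF uV _ v] by auto
  qed
qed

text \<open>
  Let \<open>c\<^sub>v\<close> be the coordinate forms of \<open>B\<close>. Then \<open>\<langle>A e, e\<rangle> = \<Sum>v u. c\<^sub>v e * M v u * \<langle>u, e\<rangle>\<close>, and summation
  over \<open>e\<close> leaves \<open>M v u * c\<^sub>v u\<close>, which vanishes for \<open>u \<noteq> v\<close>.
\<close>
lemma trace_of_matrix:
  assumes E: "orthonormal_basis V E" and A: "A \<in> lin_maps V V"
    and B: "basis B" "finite B" and M: "\<And>v. v \<in> B \<Longrightarrow> A v = lincomb (M v) B"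
  shows "(\<Sum>v\<in>B. M v v) = (\<Sum>e\<in>E. cinner V (A e) e)"
proof -
  have sub: "B \<subseteq> carrier V" using B by (simp add: basis_def)
  note Ec = orthonormal_basis_carrier[OF E]
  obtain c where c: "\<And>v. v \<in> B \<Longrightarrow> linear_form V (c v)"
    and cx: "\<And>x. x \<in> carrier V \<Longrightarrow> x = lincomb (\<lambda>v. c v x) B"
    and c\<delta>: "\<And>u v. u \<in> B \<Longrightarrow> v \<in> B \<Longrightarrow> c v u = (if u = v then 1 else 0)"
    using coordinate_forms[OF B] by blast
  have "cinner V (A e) e = (\<Sum>v\<in>B. \<Sum>u\<in>B. M v u * (cinner V u e * c v e))" if "e \<in> E" for e
  proof -
    have e: "e \<in> carrier V" using Ec[OF that] .
    have "cinner V (A e) e = (\<Sum>v\<in>B. c v e * cinner V (A v) e)"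
      using linear_form_lincomb[OF linear_form_compose[OF cinner_linear_form[OF e] A] B(2) sub,
          of "\<lambda>v. c v e"] cx[OF e] by simp
    also have "\<dots> = (\<Sum>v\<in>B. c v e * (\<Sum>u\<in>B. M v u * cinner V u e))"
      using linear_form_lincomb[OF cinner_linear_form[OF e] B(2) sub] M by simp
    finally show ?thesis by (simp add: sum_distrib_left mult_ac)
  qed
  then have "(\<Sum>e\<in>E. cinner V (A e) e)
      = (\<Sum>e\<in>E. \<Sum>v\<in>B. \<Sum>u\<in>B. M v u * (cinner V u e * c v e))" by simp
  also have "\<dots> = (\<Sum>v\<in>B. \<Sum>e\<in>E. \<Sum>u\<in>B. M v u * (cinner V u e * c v e))"
    by (rule sum.swap)
  also have "\<dots> = (\<Sum>v\<in>B. \<Sum>u\<in>B. \<Sum>e\<in>E. M v u * (cinner V u e * c v e))"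
    by (intro sum.cong refl sum.swap)
  also have "\<dots> = (\<Sum>v\<in>B. \<Sum>u\<in>B. M v u * c v u)"
    using linear_form_expansion[OF E c] sub
    by (intro sum.cong refl) (simp add: subset_iff flip: sum_distrib_left)
  also have "\<dots> = (\<Sum>v\<in>B. \<Sum>u\<in>B. if u = v then M v u else 0)"
    by (intro sum.cong) (auto simp: c\<delta>)
  also have "\<dots> = (\<Sum>v\<in>B. M v v)" using B(2) by simp
  finally show ?thesis by simp
qed

lemma lin_trace_orthonormal:
  assumes E: "orthonormal_basis V E" and A: "A \<in> lin_maps V V"
  shows "lin_trace V A = (\<Sum>e\<in>E. cinner V (A e) e)"
  unfolding lin_trace_def
proof (rule the_equality)
  have "basis E" using E by (simp add: orthonormal_basis_def)
  moreover have "A e = lincomb (\<lambda>f. cinner V (A e) f) E" if "e \<in> E" for e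
    using orthonormal_expansion[OF E] lin_mapsD(2)[OF A] orthonormal_basis_carrier[OF E that] by simp
  ultimately show "\<exists>B M. finite B \<and> basis B \<and> (\<forall>v\<in>B. A v = lincomb (M v) B) \<and>
      (\<Sum>e\<in>E. cinner V (A e) e) = (\<Sum>v\<in>B. M v v)"
    using orthonormal_basis_finite[OF E] 
    by (intro exI[of _ E] exI[of _ "\<lambda>e f. cinner V (A e) f"]) simp
next
  fix t assume "\<exists>B M. finite B \<and> basis B \<and> (\<forall>v\<in>B. A v = lincomb (M v) B) \<and> t = (\<Sum>v\<in>B. M v v)"
  then obtain B M where B: "finite B" "basis B" "\<And>v. v \<in> B \<Longrightarrow> A v = lincomb (M v) B"
    and t: "t = (\<Sum>v\<in>B. M v v)" by blast
  show "t = (\<Sum>e\<in>E. cinner V (A e) e)"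
    unfolding t by (rule trace_of_matrix[OF E A B(2,1,3)])
qed

end

text \<open>
  The Hilbert--Schmidt product is computed without adjoint and trace, by
  \<open>tr (T\<^sup>* S) = \<Sum>e. \<langle>T\<^sup>* (S e), e\<rangle> = \<Sum>e. \<langle>S e, T e\<rangle>\<close>.
\<close>
lemma (in inner_space_pair) cinner_hom_space:
  assumes E: "orthonormal_basis V E" and S: "S \<in> lin_maps V U" and T: "T \<in> lin_maps V U"
  shows "cinner (hom_space V U) S T = (\<Sum>e\<in>E. cinner U (S e) (T e)) / of_nat (cdim V)"
proof -
  note T' = adjoint[OF T]
  have "compose (carrier V) (adjoint V U T) S \<in> lin_maps V V"
    by (intro lin_mapsI) (simp_all add: compose_def lin_mapsD[OF S] lin_mapsD[OF T'(1)])
  note tr = V.lin_trace_orthonormal[OF E this]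
  have "cinner V (adjoint V U T (S e)) e = cinner U (S e) (T e)" if "e \<in> E" for e
  proof -
    have e: "e \<in> carrier V" using V.orthonormal_basis_carrier[OF E that] .
    note Se = lin_mapsD(2)[OF S e] and Te = lin_mapsD(2)[OF T e]
    show ?thesis
      using T'(2)[OF e Se] V.cinner_commute[OF e, of "adjoint V U T (S e)"] U.cinner_commute[OF Te Se]
        lin_mapsD(2)[OF T'(1) Se] by simp
  qed
  then show ?thesis
    using tr V.orthonormal_basis_carrier[OF E] by (simp add: hom_space_def compose_def)
qed

section \<open>Spaces of functions\<close>

text \<open>
  The elements of \<open>U\<close> are determined by their values at the finitely many points of \<open>P\<close>, and the scalar product
  is that of these values. The functions \<open>d p\<close> interpolate, so that \<open>\<langle>f, d p\<rangle> = f p\<close>; thus they form an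
  orthonormal basis. In a dual space, \<open>P\<close> is an orthonormal basis; in a tensor product, it is a product of two
  orthonormal bases and the \<open>d p\<close> are the pure tensors of basis vectors.
\<close>
lemma pointwise_inner_space:
  fixes U :: "('x \<Rightarrow> complex) ip_space"
  assumes ops: "\<zero>\<^bsub>U\<^esub> = (\<lambda>x\<in>X. 0)" "\<And>f g. f \<oplus>\<^bsub>U\<^esub> g = (\<lambda>x\<in>X. f x + g x)"
      "\<And>a f. a \<odot>\<^bsub>U\<^esub> f = (\<lambda>x\<in>X. a * f x)"
    and ext: "carrier U \<subseteq> extensional X"
    and zero: "(\<lambda>x\<in>X. 0) \<in> carrier U"
    and add: "\<And>f g. \<lbrakk>f \<in> carrier U; g \<in> carrier U\<rbrakk> \<Longrightarrow> (\<lambda>x\<in>X. f x + g x) \<in> carrier U"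
    and smult: "\<And>a f. f \<in> carrier U \<Longrightarrow> (\<lambda>x\<in>X. a * f x) \<in> carrier U"
    and P: "finite P" "P \<subseteq> X"
    and cinner: "\<And>f g. \<lbrakk>f \<in> carrier U; g \<in> carrier U\<rbrakk> \<Longrightarrow> cinner U f g = (\<Sum>p\<in>P. f p * cnj (g p))"
    and determined: "\<And>f x. \<lbrakk>f \<in> carrier U; \<And>p. p \<in> P \<Longrightarrow> f p = 0; x \<in> X\<rbrakk> \<Longrightarrow> f x = 0"
    and d: "\<And>p. p \<in> P \<Longrightarrow> d p \<in> carrier U"
      "\<And>p q. \<lbrakk>p \<in> P; q \<in> P\<rbrakk> \<Longrightarrow> d p q = (if p = q then 1 else 0)"
  shows "fd_inner_space U" and "orthonormal_basis U (d ` P)" and "inj_on d P"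
proof -
  have eqI: "f = g" if "f \<in> carrier U" "g \<in> carrier U" "\<And>x. x \<in> X \<Longrightarrow> f x = g x" for f g
    using that ext by (intro extensionalityI[of f X g]) auto
  have restr: "restrict f X = f" if "f \<in> carrier U" for f
    using that ext extensional_restrict by blast
  have "vectorspace CC U"
  proof (rule vs_criteria)
    show "field CC" by (rule class_field)
    show "\<forall>v\<in>carrier U. \<exists>neg_v\<in>carrier U. v \<oplus>\<^bsub>U\<^esub> neg_v = \<zero>\<^bsub>U\<^esub>"
    proof
      fix f assume "f \<in> carrier U"
      then show "\<exists>neg_v\<in>carrier U. f \<oplus>\<^bsub>U\<^esub> neg_v = \<zero>\<^bsub>U\<^esub>"
        using smult[of f "-1"] by (intro bexI[of _ "\<lambda>x\<in>X. -1 * f x"]) (auto simp: ops)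
    qed
  qed (use zero add smult in \<open>auto simp: ops restr algebra_simps cong: restrict_cong intro!: eqI\<close>)
  then interpret vectorspace CC U .
  interpret inner_space U
  proof unfold_locales
    fix f g h assume "f \<in> carrier U" "g \<in> carrier U" "h \<in> carrier U"
    then show "cinner U (f \<oplus>\<^bsub>U\<^esub> g) h = cinner U f h + cinner U g h"
      using add P by (simp add: ops cinner subset_iff sum.distrib algebra_simps)
  next
    fix a f g assume "f \<in> carrier U" "g \<in> carrier U"
    then show "cinner U (a \<odot>\<^bsub>U\<^esub> f) g = a * cinner U f g"
      using smult P by (simp add: ops cinner subset_iff sum_distrib_left algebra_simps)
  next
    fix f g assume "f \<in> carrier U" "g \<in> carrier U"
    then show "cinner U g f = cnj (cinner U f g)" by (simp add: cinner mult.commute)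
  next
    fix f assume f: "f \<in> carrier U" and "f \<noteq> \<zero>\<^bsub>U\<^esub>"
    have "\<exists>p\<in>P. f p \<noteq> 0"
    proof (rule ccontr)
      assume "\<not> (\<exists>p\<in>P. f p \<noteq> 0)"
      then have "f = \<zero>\<^bsub>U\<^esub>"
        using determined[OF f] f zero by (intro eqI) (auto simp: ops)
      with \<open>f \<noteq> \<zero>\<^bsub>U\<^esub>\<close> show False by simp
    qed
    moreover have "Re (cinner U f f) = (\<Sum>p\<in>P. (cmod (f p))\<^sup>2)"
      by (simp add: cinner f flip: complex_norm_square)
    ultimately show "0 < Re (cinner U f f)" using P by (auto intro!: sum_pos2)
  qed
  have point: "cinner U f (d p) = f p" if "f \<in> carrier U" "p \<in> P" for f p
  proof -
    have "cinner U f (d p) = (\<Sum>q\<in>P. if q = p then f q else 0)"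
      using that d by (auto simp: cinner intro!: sum.cong)
    then show ?thesis using that P by simp
  qed
  show inj: "inj_on d P" using d(2) by (intro inj_onI) (metis zero_neq_one)
  have on: "orthonormal (d ` P)"
    unfolding orthonormal_def
    using d P inj by (auto simp: point inj_on_eq_iff)
  have total: "f = \<zero>\<^bsub>U\<^esub>" if f: "f \<in> carrier U" and f0: "\<And>e. e \<in> d ` P \<Longrightarrow> cinner U f e = 0" for f
  proof (rule eqI)
    have "f p = 0" if "p \<in> P" for p
      using f0[of "d p"] point[OF f that] that by simp
    then show "f x = \<zero>\<^bsub>U\<^esub> x" if "x \<in> X" for x
      using determined[OF f _ that] that by (simp add: ops)
  qed (use f zero in \<open>simp_all add: ops\<close>)
  show "orthonormal_basis U (d ` P)"
    by (rule total_orthonormal_basis(1)[OF on total])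
  have "fin_dim" by (rule total_orthonormal_basis(2)[OF on total])
  then show "fd_inner_space U"
    by unfold_locales
      (rule cinner_add_left cinner_smult_left cinner_commute cinner_pos; assumption | assumption)+
qed

lemma function_space_inner_space:
  assumes "finite X"
  shows "fd_inner_space (function_space X)"
proof (rule pointwise_inner_space(1)[where X = X and P = X and d = "\<lambda>p. \<lambda>x\<in>X. if p = x then 1 else 0"])
qed (use assms in \<open>auto simp: function_space_def PiE_def\<close>)

lemma dual_space_carrier:
  "\<phi> \<in> carrier (dual_space W) \<longleftrightarrow> \<phi> \<in> extensional (carrier W) \<and> linear_form W \<phi>"
  by (simp add: dual_space_def linear_form_def)

lemma (in fd_inner_space) cinner_dual_space:
  assumes E: "orthonormal_basis V E" and \<phi>: "linear_form V \<phi>" and \<psi>: "linear_form V \<psi>"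
  shows "cinner (dual_space V) \<phi> \<psi> = (\<Sum>e\<in>E. \<phi> e * cnj (\<psi> e))"
proof -
  have "(THE s. \<exists>E. orthonormal_basis V E \<and> s = (\<Sum>e\<in>E. \<phi> e * cnj (\<psi> e)))
      = (\<Sum>e\<in>E. \<phi> e * cnj (\<psi> e))"
    using E sum_orthonormal_basis_independent[OF _ E \<phi> \<psi>] by (intro the_equality) blast+
  then show ?thesis by (simp add: dual_space_def)
qed

lemma (in fd_inner_space) dual_space_inner_space: "fd_inner_space (dual_space V)"
proof -
  obtain E where E: "orthonormal_basis V E" using orthonormal_basis_exists by blast
  note on = orthonormal_basis_orthonormal[OF E, unfolded orthonormal_def]
  note Ec = orthonormal_basis_carrier[OF E]
  show ?thesis
  proof (rule pointwise_inner_space(1)[where X = "carrier V" and P = E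
        and d = "\<lambda>e. \<lambda>x\<in>carrier V. cinner V x e"])
    show "(\<lambda>x\<in>carrier V. f x + g x) \<in> carrier (dual_space V)"
      if "f \<in> carrier (dual_space V)" "g \<in> carrier (dual_space V)" for f g
      using that by (simp add: dual_space_carrier linear_form_def algebra_simps)
    show "(\<lambda>x\<in>carrier V. a * f x) \<in> carrier (dual_space V)"
      if "f \<in> carrier (dual_space V)" for a f
      using that by (simp add: dual_space_carrier linear_form_def algebra_simps)
    show "(\<lambda>x\<in>carrier V. cinner V x e) \<in> carrier (dual_space V)" if "e \<in> E" for e
      using Ec[OF that] by (simp add: dual_space_carrier linear_form_def cinner_add_left cinner_smult_left)
    show "cinner (dual_space V) f g = (\<Sum>e\<in>E. f e * cnj (g e))"
      if "f \<in> carrier (dual_space V)" "g \<in> carrier (dual_space V)" for f g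
      using that cinner_dual_space[OF E] by (simp add: dual_space_carrier)
    show "f x = 0" if "f \<in> carrier (dual_space V)" "\<And>e. e \<in> E \<Longrightarrow> f e = 0" "x \<in> carrier V" for f x
      using that linear_form_expansion[OF E, of f x] by (simp add: dual_space_carrier)
    show "(\<lambda>x\<in>carrier V. cinner V x e) e' = (if e = e' then 1 else 0)" if "e \<in> E" "e' \<in> E" for e e'
      using that on Ec by auto
  qed (use on in \<open>auto simp: dual_space_def linear_form_def\<close>)
qed

section \<open>Multilinear maps and tensor products\<close>


lemma (in inner_space_pair) lin_maps_add:
  assumes "S \<in> lin_maps V U" "T \<in> lin_maps V U"
  shows "S \<oplus>\<^bsub>hom_space V U\<^esub> T \<in> lin_maps V U"
  by (intro lin_mapsI)
    (simp_all add: hom_space_def lin_mapsD[OF assms(1)] lin_mapsD[OF assms(2)] U.a_ac U.smult_r_distr)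

lemma (in inner_space_pair) lin_maps_smult:
  assumes "S \<in> lin_maps V U"
  shows "a \<odot>\<^bsub>hom_space V U\<^esub> S \<in> lin_maps V U"
  by (intro lin_mapsI)
    (simp_all add: hom_space_def lin_mapsD[OF assms(1)] U.smult_r_distr mult.commute flip: U.smult_assoc1[simplified])

text \<open>
  Bilinearity is stated by membership of the sections in \<^const>\<open>lin_maps\<close>, so that the results on linear maps
  apply to each variable.
\<close>
definition bilinear_map ::
    "'v ip_space \<Rightarrow> 'w ip_space \<Rightarrow> 'u ip_space \<Rightarrow> ('v \<Rightarrow> 'w \<Rightarrow> 'u) \<Rightarrow> bool" where
  "bilinear_map V W U b \<longleftrightarrow>
     (\<forall>w\<in>carrier W. (\<lambda>v\<in>carrier V. b v w) \<in> lin_maps V U) \<and>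
     (\<forall>v\<in>carrier V. (\<lambda>w\<in>carrier W. b v w) \<in> lin_maps W U)"

lemma bilinear_mapD:
  assumes "bilinear_map V W U b"
  shows "w \<in> carrier W \<Longrightarrow> (\<lambda>v\<in>carrier V. b v w) \<in> lin_maps V U"
    and "v \<in> carrier V \<Longrightarrow> (\<lambda>w\<in>carrier W. b v w) \<in> lin_maps W U"
    and "\<lbrakk>v \<in> carrier V; w \<in> carrier W\<rbrakk> \<Longrightarrow> b v w \<in> carrier U"
  using assms lin_mapsD(2)[of "\<lambda>v\<in>carrier V. b v w" V U v] by (auto simp: bilinear_map_def)


locale tensor_pair = V: fd_inner_space V + W: fd_inner_space W
  for V :: "'v ip_space" and W :: "'w ip_space"
begin

text \<open>
  Antilinear maps are the conjugates of linear forms; in this shape the expansion of linear forms is available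
  in each variable.
\<close>
lemma tensor_carrier:
  "B \<in> carrier (V \<otimes>\<^sub>s W) \<longleftrightarrow> B \<in> extensional (carrier V \<times> carrier W) \<and>
     (\<forall>w\<in>carrier W. linear_form V (\<lambda>v. cnj (B (v, w)))) \<and>
     (\<forall>v\<in>carrier V. linear_form W (\<lambda>w. cnj (B (v, w))))"
  unfolding tensor_def linear_form_def
  by (auto simp: complex_eq_iff algebra_simps)

text \<open>
  The two bases are exchanged one at a time; in each step the other variable is fixed.
\<close>
lemma cinner_tensor:
  assumes E: "orthonormal_basis V E" and F: "orthonormal_basis W F"
    and B: "B \<in> carrier (V \<otimes>\<^sub>s W)" and C: "C \<in> carrier (V \<otimes>\<^sub>s W)"
  shows "cinner (V \<otimes>\<^sub>s W) B C = (\<Sum>e\<in>E. \<Sum>f\<in>F. B (e, f) * cnj (C (e, f)))"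
proof -
  have "(\<Sum>e\<in>E'. \<Sum>f\<in>F'. B (e, f) * cnj (C (e, f))) = (\<Sum>e\<in>E. \<Sum>f\<in>F. B (e, f) * cnj (C (e, f)))"
    if E': "orthonormal_basis V E'" and F': "orthonormal_basis W F'" for E' F'
  proof -
    have "(\<Sum>e\<in>E'. \<Sum>f\<in>F'. B (e, f) * cnj (C (e, f)))
        = (\<Sum>e\<in>E'. \<Sum>f\<in>F. B (e, f) * cnj (C (e, f)))"
    proof (rule sum.cong[OF refl])
      fix e assume "e \<in> E'"
      then have "e \<in> carrier V" by (rule V.orthonormal_basis_carrier[OF E'])
      then show "(\<Sum>f\<in>F'. B (e, f) * cnj (C (e, f))) = (\<Sum>f\<in>F. B (e, f) * cnj (C (e, f)))"
        using W.sum_orthonormal_basis_independent[OF F' F, of "\<lambda>w. cnj (C (e, w))" "\<lambda>w. cnj (B (e, w))"] B C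
        by (simp add: tensor_carrier mult.commute)
    qed
    also have "\<dots> = (\<Sum>f\<in>F. \<Sum>e\<in>E'. B (e, f) * cnj (C (e, f)))" by (rule sum.swap)
    also have "\<dots> = (\<Sum>f\<in>F. \<Sum>e\<in>E. B (e, f) * cnj (C (e, f)))"
    proof (rule sum.cong[OF refl])
      fix f assume "f \<in> F"
      then have "f \<in> carrier W" by (rule W.orthonormal_basis_carrier[OF F])
      then show "(\<Sum>e\<in>E'. B (e, f) * cnj (C (e, f))) = (\<Sum>e\<in>E. B (e, f) * cnj (C (e, f)))"
        using V.sum_orthonormal_basis_independent[OF E' E, of "\<lambda>v. cnj (C (v, f))" "\<lambda>v. cnj (B (v, f))"] B C
        by (simp add: tensor_carrier mult.commute)
    qed
    also have "\<dots> = (\<Sum>e\<in>E. \<Sum>f\<in>F. B (e, f) * cnj (C (e, f)))" by (rule sum.swap)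
    finally show ?thesis .
  qed
  then have "(THE s. \<exists>E F. orthonormal_basis V E \<and> orthonormal_basis W F \<and>
        s = (\<Sum>e\<in>E. \<Sum>f\<in>F. B (e, f) * cnj (C (e, f)))) = (\<Sum>e\<in>E. \<Sum>f\<in>F. B (e, f) * cnj (C (e, f)))"
    using E F by (intro the_equality) blast+
  then show ?thesis by (simp add: tensor_def)
qed

lemma tensor_expansion:
  assumes E: "orthonormal_basis V E" and F: "orthonormal_basis W F"
    and B: "B \<in> carrier (V \<otimes>\<^sub>s W)" and v: "v \<in> carrier V" and w: "w \<in> carrier W"
  shows "B (v, w) = (\<Sum>e\<in>E. \<Sum>f\<in>F. B (e, f) * cnj (cinner V v e * cinner W w f))"
proof -
  have "cnj (B (v, w)) = (\<Sum>e\<in>E. cinner V v e * cnj (B (e, w)))"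
    using V.linear_form_expansion[OF E _ v, of "\<lambda>v. cnj (B (v, w))"] B w by (simp add: tensor_carrier)
  also have "\<dots> = (\<Sum>e\<in>E. cinner V v e * (\<Sum>f\<in>F. cinner W w f * cnj (B (e, f))))"
  proof (rule sum.cong[OF refl])
    fix e assume "e \<in> E"
    then have "e \<in> carrier V" by (rule V.orthonormal_basis_carrier[OF E])
    then show "cinner V v e * cnj (B (e, w)) = cinner V v e * (\<Sum>f\<in>F. cinner W w f * cnj (B (e, f)))"
      using W.linear_form_expansion[OF F _ w, of "\<lambda>w. cnj (B (e, w))"] B by (simp add: tensor_carrier)
  qed
  also have "\<dots> = cnj (\<Sum>e\<in>E. \<Sum>f\<in>F. B (e, f) * cnj (cinner V v e * cinner W w f))"
    by (simp add: sum_distrib_left mult_ac)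
  finally show ?thesis by (simp only: complex_cnj_cancel_iff)
qed

lemma pure_tensor_apply [simp]:
  "\<lbrakk>v' \<in> carrier V; w' \<in> carrier W\<rbrakk>
    \<Longrightarrow> pure_tensor V W v w (v', w') = cinner V v v' * cinner W w w'"
  by (simp add: pure_tensor_def)

lemma pure_tensor_carrier [simp]:
  assumes "v \<in> carrier V" "w \<in> carrier W"
  shows "pure_tensor V W v w \<in> carrier (V \<otimes>\<^sub>s W)"
  using assms unfolding tensor_carrier linear_form_def
  by (simp add: pure_tensor_def V.cinner_add_right V.cinner_smult_right
      W.cinner_add_right W.cinner_smult_right algebra_simps)

lemma tensor_basis:
  assumes E: "orthonormal_basis V E" and F: "orthonormal_basis W F"
  shows "fd_inner_space (V \<otimes>\<^sub>s W)"
    and "orthonormal_basis (V \<otimes>\<^sub>s W) ((\<lambda>(e, f). pure_tensor V W e f) ` (E \<times> F))"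
    and "inj_on (\<lambda>(e, f). pure_tensor V W e f) (E \<times> F)"
proof -
  note onE = V.orthonormal_basis_orthonormal[OF E, unfolded V.orthonormal_def]
  note onF = W.orthonormal_basis_orthonormal[OF F, unfolded W.orthonormal_def]
  note Ec = V.orthonormal_basis_carrier[OF E] and Fc = W.orthonormal_basis_carrier[OF F]
  have zero: "\<zero>\<^bsub>V \<otimes>\<^sub>s W\<^esub> = (\<lambda>x\<in>carrier V \<times> carrier W. 0)"
    and add: "f \<oplus>\<^bsub>V \<otimes>\<^sub>s W\<^esub> g = (\<lambda>x\<in>carrier V \<times> carrier W. f x + g x)"
    and smult: "a \<odot>\<^bsub>V \<otimes>\<^sub>s W\<^esub> f = (\<lambda>x\<in>carrier V \<times> carrier W. a * f x)" for a f g
    by (simp_all add: tensor_def)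
  have ext: "carrier (V \<otimes>\<^sub>s W) \<subseteq> extensional (carrier V \<times> carrier W)"
    by (auto simp: tensor_carrier)
  have c0: "(\<lambda>x\<in>carrier V \<times> carrier W. 0) \<in> carrier (V \<otimes>\<^sub>s W)"
    by (simp add: tensor_carrier linear_form_def)
  have c1: "(\<lambda>x\<in>carrier V \<times> carrier W. f x + g x) \<in> carrier (V \<otimes>\<^sub>s W)"
    if "f \<in> carrier (V \<otimes>\<^sub>s W)" "g \<in> carrier (V \<otimes>\<^sub>s W)" for f g
    using that by (simp add: tensor_carrier linear_form_def algebra_simps)
  have c2: "(\<lambda>x\<in>carrier V \<times> carrier W. a * f x) \<in> carrier (V \<otimes>\<^sub>s W)"
    if "f \<in> carrier (V \<otimes>\<^sub>s W)" for a f
    using that by (simp add: tensor_carrier linear_form_def algebra_simps)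
  have fin: "finite (E \<times> F)" and sub: "E \<times> F \<subseteq> carrier V \<times> carrier W" using onE onF by auto
  have ip: "cinner (V \<otimes>\<^sub>s W) f g = (\<Sum>p\<in>E \<times> F. f p * cnj (g p))"
    if "f \<in> carrier (V \<otimes>\<^sub>s W)" "g \<in> carrier (V \<otimes>\<^sub>s W)" for f g
    using cinner_tensor[OF E F that] by (simp add: sum.cartesian_product)
  have det: "f x = 0"
    if "f \<in> carrier (V \<otimes>\<^sub>s W)" "\<And>p. p \<in> E \<times> F \<Longrightarrow> f p = 0" "x \<in> carrier V \<times> carrier W" for f x
    using that tensor_expansion[OF E F that(1)] by auto
  have d1: "(case p of (e, f) \<Rightarrow> pure_tensor V W e f) \<in> carrier (V \<otimes>\<^sub>s W)" if "p \<in> E \<times> F" for p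
    using that Ec Fc by auto
  have d2: "(case p of (e, f) \<Rightarrow> pure_tensor V W e f) q = (if p = q then 1 else 0)"
    if "p \<in> E \<times> F" "q \<in> E \<times> F" for p q
  proof -
    have "cinner V e e' = (if e = e' then 1 else 0)" if "e \<in> E" "e' \<in> E" for e e'
      using that onE by auto
    moreover have "cinner W f f' = (if f = f' then 1 else 0)" if "f \<in> F" "f' \<in> F" for f f'
      using that onF by auto
    ultimately show ?thesis using that Ec Fc by (cases p; cases q) simp
  qed
  note space = pointwise_inner_space[where U = "V \<otimes>\<^sub>s W" and X = "carrier V \<times> carrier W"
      and P = "E \<times> F" and d = "\<lambda>(e, f). pure_tensor V W e f"]
  show "fd_inner_space (V \<otimes>\<^sub>s W)"
    by (rule space(1); fact zero add smult ext c0 c1 c2 fin sub ip det d1 d2)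
  show "orthonormal_basis (V \<otimes>\<^sub>s W) ((\<lambda>(e, f). pure_tensor V W e f) ` (E \<times> F))"
    by (rule space(2); fact zero add smult ext c0 c1 c2 fin sub ip det d1 d2)
  show "inj_on (\<lambda>(e, f). pure_tensor V W e f) (E \<times> F)"
    by (rule space(3); fact zero add smult ext c0 c1 c2 fin sub ip det d1 d2)
qed

lemma tensor_inner_space: "fd_inner_space (V \<otimes>\<^sub>s W)"
  using V.orthonormal_basis_exists W.orthonormal_basis_exists tensor_basis(1) by blast

lemma sum_tensor_basis:
  assumes "orthonormal_basis V E" "orthonormal_basis W F"
  shows "(\<Sum>x\<in>(\<lambda>(e, f). pure_tensor V W e f) ` (E \<times> F). h x)
      = (\<Sum>e\<in>E. \<Sum>f\<in>F. h (pure_tensor V W e f))"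
  by (subst sum.reindex[OF tensor_basis(3)[OF assms]]) (simp add: sum.cartesian_product split_beta)

text \<open>
  The pure tensors are the reproducing kernel of this space of functions.
\<close>
lemma cinner_pure_tensor:
  assumes B: "B \<in> carrier (V \<otimes>\<^sub>s W)" and v: "v \<in> carrier V" and w: "w \<in> carrier W"
  shows "cinner (V \<otimes>\<^sub>s W) B (pure_tensor V W v w) = B (v, w)"
proof -
  obtain E F where E: "orthonormal_basis V E" and F: "orthonormal_basis W F"
    using V.orthonormal_basis_exists W.orthonormal_basis_exists by blast
  show ?thesis
    using cinner_tensor[OF E F B pure_tensor_carrier[OF v w]] tensor_expansion[OF E F B v w]
      V.orthonormal_basis_carrier[OF E] W.orthonormal_basis_carrier[OF F] by simp
qed

lemma pure_tensor_linear:
  assumes "v \<in> carrier V" "w \<in> carrier W"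
  shows "v' \<in> carrier V \<Longrightarrow> pure_tensor V W (v \<oplus>\<^bsub>V\<^esub> v') w
      = pure_tensor V W v w \<oplus>\<^bsub>V \<otimes>\<^sub>s W\<^esub> pure_tensor V W v' w"
    and "w' \<in> carrier W \<Longrightarrow> pure_tensor V W v (w \<oplus>\<^bsub>W\<^esub> w')
      = pure_tensor V W v w \<oplus>\<^bsub>V \<otimes>\<^sub>s W\<^esub> pure_tensor V W v w'"
    and "pure_tensor V W (a \<odot>\<^bsub>V\<^esub> v) w = a \<odot>\<^bsub>V \<otimes>\<^sub>s W\<^esub> pure_tensor V W v w"
    and "pure_tensor V W v (a \<odot>\<^bsub>W\<^esub> w) = a \<odot>\<^bsub>V \<otimes>\<^sub>s W\<^esub> pure_tensor V W v w"
  unfolding tensor_def using assms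
  by (auto simp: pure_tensor_def V.cinner_add_left V.cinner_smult_left
      W.cinner_add_left W.cinner_smult_left algebra_simps intro!: restrict_ext)

lemma tensor_lin_maps_eqI:
  assumes U: "fd_inner_space U" and S: "S \<in> lin_maps (V \<otimes>\<^sub>s W) U" and T: "T \<in> lin_maps (V \<otimes>\<^sub>s W) U"
    and eq: "\<And>v w. \<lbrakk>v \<in> carrier V; w \<in> carrier W\<rbrakk>
      \<Longrightarrow> S (pure_tensor V W v w) = T (pure_tensor V W v w)"
  shows "S = T"
proof -
  interpret VW: fd_inner_space "V \<otimes>\<^sub>s W" by (rule tensor_inner_space)
  interpret U: fd_inner_space U by (rule U)
  interpret VWU: inner_space_pair "V \<otimes>\<^sub>s W" U ..
  obtain E F where E: "orthonormal_basis V E" and F: "orthonormal_basis W F"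
    using V.orthonormal_basis_exists W.orthonormal_basis_exists by blast
  show ?thesis
    using eq V.orthonormal_basis_carrier[OF E] W.orthonormal_basis_carrier[OF F]
    by (intro VWU.lin_maps_eqI[OF tensor_basis(2)[OF E F] S T]) auto
qed

text \<open>
  Together with \<open>tensor_lin_maps_eqI\<close>, the universal property of the tensor product. The map is prescribed on the
  basis of the \<open>e \<otimes> f\<close>; on general pure tensors the two variables are expanded one after the other.
\<close>
lemma bilinear_extension:
  assumes U: "fd_inner_space U" and b: "bilinear_map V W U b"
  obtains T where "T \<in> lin_maps (V \<otimes>\<^sub>s W) U"
    "\<And>v w. \<lbrakk>v \<in> carrier V; w \<in> carrier W\<rbrakk> \<Longrightarrow> T (pure_tensor V W v w) = b v w"
proof -
  interpret VW: fd_inner_space "V \<otimes>\<^sub>s W" by (rule tensor_inner_space)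
  interpret U: fd_inner_space U by (rule U)
  interpret VWU: inner_space_pair "V \<otimes>\<^sub>s W" U ..
  interpret VU: inner_space_pair V U ..
  interpret WU: inner_space_pair W U ..
  obtain E F where E: "orthonormal_basis V E" and F: "orthonormal_basis W F"
    using V.orthonormal_basis_exists W.orthonormal_basis_exists by blast
  note Ec = V.orthonormal_basis_carrier[OF E] and Fc = W.orthonormal_basis_carrier[OF F]
  note bas = tensor_basis[OF E F]
  let ?d = "\<lambda>(e, f). pure_tensor V W e f"
  \<comment> \<open>\<open>t\<close> recovers the pair \<open>(e, f)\<close> from the basis vector \<open>e \<otimes> f\<close> and applies \<open>b\<close> to it.\<close>
  define t where "t x = case_prod b (the_inv_into (E \<times> F) ?d x)" for x
  have t: "t (pure_tensor V W e f) = b e f" if "e \<in> E" "f \<in> F" for e f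
    using the_inv_into_f_f[OF bas(3), of "(e, f)"] that by (simp add: t_def)
  have tU: "t x \<in> carrier U" if "x \<in> ?d ` (E \<times> F)" for x
    using that t bilinear_mapD(3)[OF b] Ec Fc by auto
  obtain T where T: "T \<in> lin_maps (V \<otimes>\<^sub>s W) U"
    and Tx: "\<And>x u. x \<in> carrier (V \<otimes>\<^sub>s W) \<Longrightarrow> u \<in> carrier U \<Longrightarrow>
        cinner U (T x) u = (\<Sum>d\<in>?d ` (E \<times> F). cinner (V \<otimes>\<^sub>s W) x d * cinner U (t d) u)"
    by (rule VWU.linear_extension[where t = t, OF bas(2)]) (erule tU, rule that)
  show thesis
  proof (rule that[OF T])
    fix v w assume v: "v \<in> carrier V" and w: "w \<in> carrier W"
    show "T (pure_tensor V W v w) = b v w"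
    proof (rule U.cinner_eqI)
      fix u assume u: "u \<in> carrier U"
      have "cinner U (T (pure_tensor V W v w)) u
          = (\<Sum>e\<in>E. \<Sum>f\<in>F. cinner V v e * cinner W w f * cinner U (b e f) u)"
        using Ec Fc v w u by (simp add: Tx sum_tensor_basis[OF E F] cinner_pure_tensor t)
      also have "\<dots> = (\<Sum>e\<in>E. cinner V v e * (\<Sum>f\<in>F. cinner W w f * cinner U (b e f) u))"
        by (simp add: sum_distrib_left mult_ac)
      also have "\<dots> = (\<Sum>e\<in>E. cinner V v e * cinner U (b e w) u)"
        using W.linear_form_expansion[OF F WU.linear_form_image[OF bilinear_mapD(2)[OF b] u] w] Ec Fc w
        by simp
      also have "\<dots> = cinner U (b v w) u"
        using V.linear_form_expansion[OF E VU.linear_form_image[OF bilinear_mapD(1)[OF b w] u] v] Ec v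
        by simp
      finally show "cinner U (T (pure_tensor V W v w)) u = cinner U (b v w) u" .
    qed (use lin_mapsD(2)[OF T] bilinear_mapD(3)[OF b] v w in auto)
  qed
qed

lemma tensor_map:
  assumes A: "A \<in> lin_maps V V" and B: "B \<in> lin_maps W W"
  shows "tensor_map V W A B \<in> lin_maps (V \<otimes>\<^sub>s W) (V \<otimes>\<^sub>s W)"
    and "\<lbrakk>v \<in> carrier V; w \<in> carrier W\<rbrakk>
      \<Longrightarrow> tensor_map V W A B (pure_tensor V W v w) = pure_tensor V W (A v) (B w)"
proof -
  have "bilinear_map V W (V \<otimes>\<^sub>s W) (\<lambda>v w. pure_tensor V W (A v) (B w))"
    unfolding bilinear_map_def
    by (auto intro!: lin_mapsI simp: pure_tensor_linear lin_mapsD[OF A] lin_mapsD[OF B])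
  then obtain T where T: "T \<in> lin_maps (V \<otimes>\<^sub>s W) (V \<otimes>\<^sub>s W)"
    "\<And>v w. \<lbrakk>v \<in> carrier V; w \<in> carrier W\<rbrakk>
       \<Longrightarrow> T (pure_tensor V W v w) = pure_tensor V W (A v) (B w)"
    using bilinear_extension[OF tensor_inner_space] by blast
  have "\<exists>!T. T \<in> lin_maps (V \<otimes>\<^sub>s W) (V \<otimes>\<^sub>s W) \<and> (\<forall>v\<in>carrier V. \<forall>w\<in>carrier W.
          T (pure_tensor V W v w) = pure_tensor V W (A v) (B w))"
    using T tensor_lin_maps_eqI[OF tensor_inner_space] by (intro ex1I[of _ T]) auto
  from theI'[OF this] show "tensor_map V W A B \<in> lin_maps (V \<otimes>\<^sub>s W) (V \<otimes>\<^sub>s W)"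
    and "\<lbrakk>v \<in> carrier V; w \<in> carrier W\<rbrakk>
      \<Longrightarrow> tensor_map V W A B (pure_tensor V W v w) = pure_tensor V W (A v) (B w)"
    by (auto simp: tensor_map_def)
qed

lemma cdim_tensor: "cdim (V \<otimes>\<^sub>s W) = cdim V * cdim W"
proof -
  interpret VW: fd_inner_space "V \<otimes>\<^sub>s W" by (rule tensor_inner_space)
  obtain E F where E: "orthonormal_basis V E" and F: "orthonormal_basis W F"
    using V.orthonormal_basis_exists W.orthonormal_basis_exists by blast
  show ?thesis
    using VW.card_orthonormal_basis[OF tensor_basis(2)[OF E F]] card_image[OF tensor_basis(3)[OF E F]]
      V.card_orthonormal_basis[OF E] W.card_orthonormal_basis[OF F] by (simp add: card_cartesian_product)
qed

end

lemma lin_maps_compose: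
  assumes S: "S \<in> lin_maps V U" and T: "T \<in> lin_maps U Z" and V: "vectorspace CC V"
  shows "(\<lambda>v\<in>carrier V. T (S v)) \<in> lin_maps V Z"
proof -
  interpret vectorspace CC V by (rule V)
  show ?thesis by (intro lin_mapsI) (simp_all add: lin_mapsD[OF S] lin_mapsD[OF T])
qed

lemma hom_space_apply:
  "v \<in> carrier V \<Longrightarrow> (S \<oplus>\<^bsub>hom_space V U\<^esub> T) v = S v \<oplus>\<^bsub>U\<^esub> T v"
  "v \<in> carrier V \<Longrightarrow> (a \<odot>\<^bsub>hom_space V U\<^esub> S) v = a \<odot>\<^bsub>U\<^esub> S v"
  by (simp_all add: hom_space_def)

locale tensor_triple = V1: fd_inner_space V\<^sub>1 + V2: fd_inner_space V\<^sub>2 + W: fd_inner_space W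
  for V\<^sub>1 :: "'a ip_space" and V\<^sub>2 :: "'b ip_space" and W :: "'w ip_space"
begin

sublocale V12: tensor_pair V\<^sub>1 V\<^sub>2 ..
sublocale V2W: tensor_pair V\<^sub>2 W ..
sublocale T12: fd_inner_space "V\<^sub>1 \<otimes>\<^sub>s V\<^sub>2" by (rule V12.tensor_inner_space)
sublocale T2W: fd_inner_space "V\<^sub>2 \<otimes>\<^sub>s W" by (rule V2W.tensor_inner_space)
sublocale V12W: tensor_pair V\<^sub>1 "V\<^sub>2 \<otimes>\<^sub>s W" ..
sublocale T12W: fd_inner_space "V\<^sub>1 \<otimes>\<^sub>s V\<^sub>2 \<otimes>\<^sub>s W" by (rule V12W.tensor_inner_space)

abbreviation pure3 :: "'a \<Rightarrow> 'b \<Rightarrow> 'w \<Rightarrow> 'a \<times> ('b \<times> 'w \<Rightarrow> complex) \<Rightarrow> complex" where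
  "pure3 v\<^sub>1 v\<^sub>2 w \<equiv> pure_tensor V\<^sub>1 (V\<^sub>2 \<otimes>\<^sub>s W) v\<^sub>1 (pure_tensor V\<^sub>2 W v\<^sub>2 w)"

lemma triple_lin_maps_eqI:
  assumes U: "fd_inner_space U" and S: "S \<in> lin_maps (V\<^sub>1 \<otimes>\<^sub>s V\<^sub>2 \<otimes>\<^sub>s W) U"
    and T: "T \<in> lin_maps (V\<^sub>1 \<otimes>\<^sub>s V\<^sub>2 \<otimes>\<^sub>s W) U"
    and eq: "\<And>x y z. \<lbrakk>x \<in> carrier V\<^sub>1; y \<in> carrier V\<^sub>2; z \<in> carrier W\<rbrakk> \<Longrightarrow> S (pure3 x y z) = T (pure3 x y z)"
  shows "S = T"
proof (rule V12W.tensor_lin_maps_eqI[OF U S T])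
  fix x q assume x: "x \<in> carrier V\<^sub>1" and q: "q \<in> carrier (V\<^sub>2 \<otimes>\<^sub>s W)"
  have slice: "(\<lambda>q\<in>carrier (V\<^sub>2 \<otimes>\<^sub>s W). R (pure_tensor V\<^sub>1 (V\<^sub>2 \<otimes>\<^sub>s W) x q)) \<in> lin_maps (V\<^sub>2 \<otimes>\<^sub>s W) U"
    if R: "R \<in> lin_maps (V\<^sub>1 \<otimes>\<^sub>s V\<^sub>2 \<otimes>\<^sub>s W) U" for R
    using x by (intro lin_mapsI) (simp_all add: lin_mapsD[OF R] V12W.pure_tensor_linear)
  from V2W.tensor_lin_maps_eqI[OF U slice[OF S] slice[OF T]] eq[OF x]
  have "(\<lambda>q\<in>carrier (V\<^sub>2 \<otimes>\<^sub>s W). S (pure_tensor V\<^sub>1 (V\<^sub>2 \<otimes>\<^sub>s W) x q))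
      = (\<lambda>q\<in>carrier (V\<^sub>2 \<otimes>\<^sub>s W). T (pure_tensor V\<^sub>1 (V\<^sub>2 \<otimes>\<^sub>s W) x q))" by simp
  from fun_cong[OF this, of q] q
  show "S (pure_tensor V\<^sub>1 (V\<^sub>2 \<otimes>\<^sub>s W) x q) = T (pure_tensor V\<^sub>1 (V\<^sub>2 \<otimes>\<^sub>s W) x q)" by simp
qed

text \<open>
  For fixed \<open>x\<close>, the bilinear map \<open>t x\<close> extends to a linear map \<open>L x\<close> on \<open>V\<^sub>2 \<otimes> W\<close>. Since linear maps on
  \<open>V\<^sub>2 \<otimes> W\<close> are determined by pure tensors, \<open>L x\<close> depends linearly on \<open>x\<close>, so that \<open>(x, q) \<mapsto> L x q\<close> is
  bilinear and extends in turn.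
\<close>
lemma trilinear_extension:
  assumes U: "fd_inner_space U"
    and t1: "\<And>y z. \<lbrakk>y \<in> carrier V\<^sub>2; z \<in> carrier W\<rbrakk> \<Longrightarrow> (\<lambda>x\<in>carrier V\<^sub>1. t x y z) \<in> lin_maps V\<^sub>1 U"
    and t2: "\<And>x. x \<in> carrier V\<^sub>1 \<Longrightarrow> bilinear_map V\<^sub>2 W U (t x)"
  obtains T where "T \<in> lin_maps (V\<^sub>1 \<otimes>\<^sub>s V\<^sub>2 \<otimes>\<^sub>s W) U"
    "\<And>x y z. \<lbrakk>x \<in> carrier V\<^sub>1; y \<in> carrier V\<^sub>2; z \<in> carrier W\<rbrakk> \<Longrightarrow> T (pure3 x y z) = t x y z"
proof -
  interpret U: fd_inner_space U by (rule U)
  interpret QU: inner_space_pair "V\<^sub>2 \<otimes>\<^sub>s W" U ..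
  have "\<exists>L. L \<in> lin_maps (V\<^sub>2 \<otimes>\<^sub>s W) U \<and>
      (\<forall>y\<in>carrier V\<^sub>2. \<forall>z\<in>carrier W. L (pure_tensor V\<^sub>2 W y z) = t x y z)" if x: "x \<in> carrier V\<^sub>1" for x
    by (rule V2W.bilinear_extension[OF U t2[OF x]]) blast
  then obtain L where L: "\<And>x. x \<in> carrier V\<^sub>1 \<Longrightarrow> L x \<in> lin_maps (V\<^sub>2 \<otimes>\<^sub>s W) U"
    and Lt: "\<And>x y z. \<lbrakk>x \<in> carrier V\<^sub>1; y \<in> carrier V\<^sub>2; z \<in> carrier W\<rbrakk>
        \<Longrightarrow> L x (pure_tensor V\<^sub>2 W y z) = t x y z"
    by metis
  have add: "L (x \<oplus>\<^bsub>V\<^sub>1\<^esub> x') q = L x q \<oplus>\<^bsub>U\<^esub> L x' q"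
    if "x \<in> carrier V\<^sub>1" "x' \<in> carrier V\<^sub>1" "q \<in> carrier (V\<^sub>2 \<otimes>\<^sub>s W)" for x x' q
  proof -
    have "L (x \<oplus>\<^bsub>V\<^sub>1\<^esub> x') = L x \<oplus>\<^bsub>hom_space (V\<^sub>2 \<otimes>\<^sub>s W) U\<^esub> L x'"
    proof (rule V2W.tensor_lin_maps_eqI[OF U L QU.lin_maps_add[OF L L]])
      fix y z assume "y \<in> carrier V\<^sub>2" "z \<in> carrier W"
      then show "L (x \<oplus>\<^bsub>V\<^sub>1\<^esub> x') (pure_tensor V\<^sub>2 W y z)
          = (L x \<oplus>\<^bsub>hom_space (V\<^sub>2 \<otimes>\<^sub>s W) U\<^esub> L x') (pure_tensor V\<^sub>2 W y z)"
        using that lin_mapsD(3)[OF t1, of y z x x'] by (simp add: hom_space_apply Lt)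
    qed (use that in auto)
    then show ?thesis using that by (simp add: hom_space_apply)
  qed
  have smult: "L (a \<odot>\<^bsub>V\<^sub>1\<^esub> x) q = a \<odot>\<^bsub>U\<^esub> L x q"
    if "x \<in> carrier V\<^sub>1" "q \<in> carrier (V\<^sub>2 \<otimes>\<^sub>s W)" for a x q
  proof -
    have "L (a \<odot>\<^bsub>V\<^sub>1\<^esub> x) = a \<odot>\<^bsub>hom_space (V\<^sub>2 \<otimes>\<^sub>s W) U\<^esub> L x"
    proof (rule V2W.tensor_lin_maps_eqI[OF U L QU.lin_maps_smult[OF L]])
      fix y z assume "y \<in> carrier V\<^sub>2" "z \<in> carrier W"
      then show "L (a \<odot>\<^bsub>V\<^sub>1\<^esub> x) (pure_tensor V\<^sub>2 W y z)
          = (a \<odot>\<^bsub>hom_space (V\<^sub>2 \<otimes>\<^sub>s W) U\<^esub> L x) (pure_tensor V\<^sub>2 W y z)"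
        using that lin_mapsD(4)[OF t1, of y z x a] by (simp add: hom_space_apply Lt)
    qed (use that in auto)
    then show ?thesis using that by (simp add: hom_space_apply)
  qed
  have "bilinear_map V\<^sub>1 (V\<^sub>2 \<otimes>\<^sub>s W) U L"
    unfolding bilinear_map_def
    by (auto intro!: lin_mapsI simp: add smult lin_mapsD[OF L])
  then obtain T where "T \<in> lin_maps (V\<^sub>1 \<otimes>\<^sub>s V\<^sub>2 \<otimes>\<^sub>s W) U"
    and "\<And>x q. \<lbrakk>x \<in> carrier V\<^sub>1; q \<in> carrier (V\<^sub>2 \<otimes>\<^sub>s W)\<rbrakk>
        \<Longrightarrow> T (pure_tensor V\<^sub>1 (V\<^sub>2 \<otimes>\<^sub>s W) x q) = L x q"
    using V12W.bilinear_extension[OF U] by blast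
  then show thesis using Lt by (intro that[of T]) simp_all
qed

lemma sum_triple_basis:
  assumes E: "orthonormal_basis V\<^sub>1 E" and F: "orthonormal_basis V\<^sub>2 F" and K: "orthonormal_basis W K"
  obtains D where "orthonormal_basis (V\<^sub>1 \<otimes>\<^sub>s V\<^sub>2 \<otimes>\<^sub>s W) D"
    "\<And>h. (\<Sum>d\<in>D. h d) = (\<Sum>e\<in>E. \<Sum>f\<in>F. \<Sum>k\<in>K. h (pure3 e f k) :: complex)"
proof (rule that)
  note FK = V2W.tensor_basis(2)[OF F K]
  show "orthonormal_basis (V\<^sub>1 \<otimes>\<^sub>s V\<^sub>2 \<otimes>\<^sub>s W) ((\<lambda>(e, q). pure_tensor V\<^sub>1 (V\<^sub>2 \<otimes>\<^sub>s W) e q) `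
      (E \<times> (\<lambda>(f, k). pure_tensor V\<^sub>2 W f k) ` (F \<times> K)))"
    by (rule V12W.tensor_basis(2)[OF E FK])
  show "(\<Sum>d\<in>(\<lambda>(e, q). pure_tensor V\<^sub>1 (V\<^sub>2 \<otimes>\<^sub>s W) e q) `
      (E \<times> (\<lambda>(f, k). pure_tensor V\<^sub>2 W f k) ` (F \<times> K)). h d)
      = (\<Sum>e\<in>E. \<Sum>f\<in>F. \<Sum>k\<in>K. h (pure3 e f k) :: complex)" for h
    by (simp only: V12W.sum_tensor_basis[OF E FK] V2W.sum_tensor_basis[OF F K])
qed

end

section \<open>Unitary representations\<close>

context unitary_rep
begin

lemma rep_closed [simp]: "\<lbrakk>g \<in> carrier \<Gamma>; x \<in> carrier V\<rbrakk> \<Longrightarrow> \<sigma> g x \<in> carrier V"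
  using lin_mapsD(2)[OF linear] .

lemma rep_one [simp]: "x \<in> carrier V \<Longrightarrow> \<sigma> \<one>\<^bsub>\<Gamma>\<^esub> x = x"
  using id_eq_one by (metis restrict_apply')

text \<open>
  The image is total: a vector orthogonal to it is \<open>\<sigma> g y\<close> for some \<open>y\<close>, and \<open>y\<close> is orthogonal to \<open>E\<close>.
\<close>
lemma image_orthonormal_basis:
  assumes E: "orthonormal_basis V E" and g: "g \<in> carrier \<Gamma>"
  shows "orthonormal_basis V (\<sigma> g ` E)" and "inj_on (\<sigma> g) E"
proof -
  note on = orthonormal_basis_orthonormal[OF E, unfolded orthonormal_def]
  note Ec = orthonormal_basis_carrier[OF E]
  show inj: "inj_on (\<sigma> g) E" using inj_prop[OF g] on inj_on_subset by blast
  show "orthonormal_basis V (\<sigma> g ` E)"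
  proof (rule total_orthonormal_basis(1))
    show "orthonormal (\<sigma> g ` E)"
      using on g Ec unitary inj by (auto simp: orthonormal_def inj_on_eq_iff)
  next
    fix x assume "x \<in> carrier V" and orth: "\<And>e. e \<in> \<sigma> g ` E \<Longrightarrow> cinner V x e = 0"
    then obtain y where y: "y \<in> carrier V" "x = \<sigma> g y" using surj_prop[OF g] by blast
    have "cinner V y e = 0" if "e \<in> E" for e
      using orth[of "\<sigma> g e"] unitary[OF g y(1) Ec[OF that]] that y(2) by simp
    then have "y = \<zero>\<^bsub>V\<^esub>" by (rule orthonormal_basis_totalD[OF E y(1)])
    then have "cinner V x x = 0" using unitary[OF g y(1) y(1)] y by simp
    then show "x = \<zero>\<^bsub>V\<^esub>" using eq_zeroI[OF \<open>x \<in> carrier V\<close>] by simp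
  qed
qed

lemma cdim_nonzero: "cdim V \<noteq> 0"
proof
  obtain E where E: "orthonormal_basis V E" using orthonormal_basis_exists by blast
  assume "cdim V = 0"
  then have "E = {}" using card_orthonormal_basis[OF E] orthonormal_basis_finite[OF E] by simp
  then have "carrier V \<subseteq> {\<zero>\<^bsub>V\<^esub>}" using orthonormal_basis_totalD[OF E] by auto
  then show False using nonzero zero_closed by blast
qed

end

section \<open>Frobenius reciprocity for the action on \<open>G \<times> G\<close>\<close>

locale triple_reps =
  G: group G + R1: unitary_rep G V\<^sub>1 \<rho>\<^sub>1 + R2: unitary_rep G V\<^sub>2 \<rho>\<^sub>2 +
  R: unitary_rep "G\<lparr>carrier := H\<rparr>" W \<theta>
  for G :: "('g, 'm) monoid_scheme" (structure) and H :: "'g set"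
    and V\<^sub>1 :: "'a ip_space" and \<rho>\<^sub>1 :: "'g \<Rightarrow> 'a \<Rightarrow> 'a"
    and V\<^sub>2 :: "'b ip_space" and \<rho>\<^sub>2 :: "'g \<Rightarrow> 'b \<Rightarrow> 'b"
    and W :: "'w ip_space" and \<theta> :: "'g \<Rightarrow> 'w \<Rightarrow> 'w" +
  assumes finite_group: "finite (carrier G)" and subgroup: "subgroup H G"
begin

sublocale tensor_triple V\<^sub>1 V\<^sub>2 W ..

abbreviation "L \<equiv> function_space (carrier G \<times> carrier G)"
abbreviation "\<sigma> \<equiv> outer_tensor_rep V\<^sub>1 (V\<^sub>2 \<otimes>\<^sub>s W) \<rho>\<^sub>1 (outer_tensor_rep V\<^sub>2 W \<rho>\<^sub>2 \<theta>)"
abbreviation "\<tau> \<equiv> inner_tensor_rep V\<^sub>1 V\<^sub>2 \<rho>\<^sub>1 \<rho>\<^sub>2"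
abbreviation "\<theta>' \<equiv> conjugate_rep (G\<lparr>carrier := H\<rparr>) W \<theta>"
abbreviation "X \<equiv> intertwiners (G \<times>\<times> G \<times>\<times> G\<lparr>carrier := H\<rparr>) (V\<^sub>1 \<otimes>\<^sub>s V\<^sub>2 \<otimes>\<^sub>s W) \<sigma> L (eta G)"
abbreviation "Y \<equiv> intertwiners (G\<lparr>carrier := H\<rparr>) (V\<^sub>1 \<otimes>\<^sub>s V\<^sub>2) \<tau> (dual_space W) \<theta>'"
definition \<kappa> :: complex where
  "\<kappa> = complex_of_real (real (card (carrier G)) / sqrt (real (cdim W)))"

sublocale L: fd_inner_space L using finite_group by (intro function_space_inner_space) simp
sublocale D: fd_inner_space "dual_space W" by (rule R.dual_space_inner_space)
sublocale XL: inner_space_pair "V\<^sub>1 \<otimes>\<^sub>s V\<^sub>2 \<otimes>\<^sub>s W" L ..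
sublocale YD: inner_space_pair "V\<^sub>1 \<otimes>\<^sub>s V\<^sub>2" "dual_space W" ..

lemma in_X_iff:
  "T \<in> carrier X \<longleftrightarrow> T \<in> lin_maps (V\<^sub>1 \<otimes>\<^sub>s V\<^sub>2 \<otimes>\<^sub>s W) L \<and>
     (\<forall>a\<in>carrier G. \<forall>b\<in>carrier G. \<forall>h\<in>H. \<forall>v\<in>carrier (V\<^sub>1 \<otimes>\<^sub>s V\<^sub>2 \<otimes>\<^sub>s W).
        T (\<sigma> (a, b, h) v) = eta G (a, b, h) (T v))"
  by (auto simp: intertwiners_def)

lemma in_Y_iff:
  "S \<in> carrier Y \<longleftrightarrow> S \<in> lin_maps (V\<^sub>1 \<otimes>\<^sub>s V\<^sub>2) (dual_space W) \<and>
     (\<forall>h\<in>H. \<forall>v\<in>carrier (V\<^sub>1 \<otimes>\<^sub>s V\<^sub>2). S (\<tau> h v) = \<theta>' h (S v))"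
  by (auto simp: intertwiners_def)

lemma H_carrier: "h \<in> H \<Longrightarrow> h \<in> carrier G"
  using subgroup.mem_carrier[OF subgroup] .

lemma H_inv: "h \<in> H \<Longrightarrow> inv\<^bsub>G\<lparr>carrier := H\<rparr>\<^esub> h = inv h" "h \<in> H \<Longrightarrow> inv h \<in> H"
  using G.m_inv_consistent[OF subgroup] subgroup.m_inv_closed[OF subgroup] by auto

lemma \<theta>_simps [simp]:
  "\<lbrakk>h \<in> H; w \<in> carrier W\<rbrakk> \<Longrightarrow> \<theta> h w \<in> carrier W"
  "w \<in> carrier W \<Longrightarrow> \<theta> \<one> w = w"
  using R.rep_closed[of h w] R.rep_one[of w] by simp_all

lemma \<theta>_inverse: "\<lbrakk>h \<in> H; w \<in> carrier W\<rbrakk> \<Longrightarrow> \<theta> h (\<theta> (inv h) w) = w"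
  using R.composition_rule[of w h "inv h"] H_inv(2)[of h] H_carrier[of h] by simp

text \<open>
  Intertwining relations are checked on pure tensors, on which the actions are explicit; as all the maps involved
  are linear, this suffices.
\<close>
lemma \<sigma>_pure:
  assumes "a \<in> carrier G" "b \<in> carrier G" "h \<in> H"
  shows "\<sigma> (a, b, h) \<in> lin_maps (V\<^sub>1 \<otimes>\<^sub>s V\<^sub>2 \<otimes>\<^sub>s W) (V\<^sub>1 \<otimes>\<^sub>s V\<^sub>2 \<otimes>\<^sub>s W)"
    and "\<lbrakk>x \<in> carrier V\<^sub>1; y \<in> carrier V\<^sub>2; z \<in> carrier W\<rbrakk>
      \<Longrightarrow> \<sigma> (a, b, h) (pure3 x y z) = pure3 (\<rho>\<^sub>1 a x) (\<rho>\<^sub>2 b y) (\<theta> h z)"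
proof -
  have \<theta>: "\<theta> h \<in> lin_maps W W" using R.linear[of h] assms by simp
  note 1 = V2W.tensor_map[OF R2.linear[OF assms(2)] \<theta>]
  note 2 = V12W.tensor_map[OF R1.linear[OF assms(1)] 1(1)]
  show "\<sigma> (a, b, h) \<in> lin_maps (V\<^sub>1 \<otimes>\<^sub>s V\<^sub>2 \<otimes>\<^sub>s W) (V\<^sub>1 \<otimes>\<^sub>s V\<^sub>2 \<otimes>\<^sub>s W)"
    using 2(1) by (simp add: outer_tensor_rep_def)
  show "\<sigma> (a, b, h) (pure3 x y z) = pure3 (\<rho>\<^sub>1 a x) (\<rho>\<^sub>2 b y) (\<theta> h z)"
    if "x \<in> carrier V\<^sub>1" "y \<in> carrier V\<^sub>2" "z \<in> carrier W"
    using 1(2) 2(2) that by (simp add: outer_tensor_rep_def)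
qed

lemma \<tau>_pure:
  assumes "h \<in> H"
  shows "\<tau> h \<in> lin_maps (V\<^sub>1 \<otimes>\<^sub>s V\<^sub>2) (V\<^sub>1 \<otimes>\<^sub>s V\<^sub>2)"
    and "\<lbrakk>x \<in> carrier V\<^sub>1; y \<in> carrier V\<^sub>2\<rbrakk>
      \<Longrightarrow> \<tau> h (pure_tensor V\<^sub>1 V\<^sub>2 x y) = pure_tensor V\<^sub>1 V\<^sub>2 (\<rho>\<^sub>1 h x) (\<rho>\<^sub>2 h y)"
  using V12.tensor_map[OF R1.linear R2.linear, OF H_carrier H_carrier, OF assms assms]
  by (simp_all add: inner_tensor_rep_def)

lemma function_space_apply:
  assumes "p \<in> carrier G \<times> carrier G"
  shows "(f \<oplus>\<^bsub>L\<^esub> g) p = f p + g p" "(a \<odot>\<^bsub>L\<^esub> f) p = a * f p"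
  using assms by (auto simp: function_space_def)

lemma function_space_eqI: "\<lbrakk>f \<in> carrier L; g \<in> carrier L;
    \<And>g\<^sub>1 g\<^sub>2. \<lbrakk>g\<^sub>1 \<in> carrier G; g\<^sub>2 \<in> carrier G\<rbrakk> \<Longrightarrow> f (g\<^sub>1, g\<^sub>2) = g (g\<^sub>1, g\<^sub>2)\<rbrakk> \<Longrightarrow> f = g"
  by (rule extensionalityI[of f "carrier G \<times> carrier G"]) (auto simp: function_space_def PiE_def)

lemma eta_apply:
  assumes "f \<in> carrier L" "g\<^sub>3 \<in> carrier G" "g\<^sub>4 \<in> carrier G"
  shows "eta G (a, b, h) f (g\<^sub>3, g\<^sub>4) = f (inv a \<otimes> g\<^sub>3 \<otimes> b, inv b \<otimes> g\<^sub>4 \<otimes> h)"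
  using assms by (simp add: eta_def)

lemma eta_linear:
  assumes "a \<in> carrier G" "b \<in> carrier G" "h \<in> H"
  shows "eta G (a, b, h) \<in> lin_maps L L"
proof (rule lin_mapsI)
  note h = H_carrier[OF assms(3)]
  show "eta G (a, b, h) \<in> extensional (carrier L)" by (simp add: eta_def)
  show cl: "eta G (a, b, h) f \<in> carrier L" if "f \<in> carrier L" for f
    using that by (auto simp: eta_def function_space_def split: if_splits)
  show "eta G (a, b, h) (f \<oplus>\<^bsub>L\<^esub> g) = eta G (a, b, h) f \<oplus>\<^bsub>L\<^esub> eta G (a, b, h) g"
    if "f \<in> carrier L" "g \<in> carrier L" for f g
    using that assms h by (intro function_space_eqI) (simp_all add: cl eta_apply function_space_apply)
  show "eta G (a, b, h) (c \<odot>\<^bsub>L\<^esub> f) = c \<odot>\<^bsub>L\<^esub> eta G (a, b, h) f" if "f \<in> carrier L" for c f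
    using that assms h by (intro function_space_eqI) (simp_all add: cl eta_apply function_space_apply)
qed

lemma \<theta>'_apply:
  assumes "h \<in> H" "\<phi> \<in> carrier (dual_space W)" "w \<in> carrier W"
  shows "\<theta>' h \<phi> w = \<phi> (\<theta> (inv h) w)"
  using assms by (simp add: conjugate_rep_def H_inv)

lemma dual_space_apply:
  assumes "w \<in> carrier W"
  shows "(\<phi> \<oplus>\<^bsub>dual_space W\<^esub> \<psi>) w = \<phi> w + \<psi> w" "(a \<odot>\<^bsub>dual_space W\<^esub> \<phi>) w = a * \<phi> w"
  using assms by (auto simp: dual_space_def)

lemma dual_space_eqI: "\<lbrakk>\<phi> \<in> carrier (dual_space W); \<psi> \<in> carrier (dual_space W);
    \<And>w. w \<in> carrier W \<Longrightarrow> \<phi> w = \<psi> w\<rbrakk> \<Longrightarrow> \<phi> = \<psi>"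
  by (auto simp: dual_space_carrier intro: extensionalityI)

lemma \<theta>'_linear:
  assumes h: "h \<in> H"
  shows "\<theta>' h \<in> lin_maps (dual_space W) (dual_space W)"
proof (rule lin_mapsI)
  have \<theta>: "\<theta> (inv h) \<in> lin_maps W W" using R.linear[of "inv h"] H_inv(2)[OF h] by simp
  show "\<theta>' h \<in> extensional (carrier (dual_space W))" by (simp add: conjugate_rep_def)
  show cl: "\<theta>' h \<phi> \<in> carrier (dual_space W)" if "\<phi> \<in> carrier (dual_space W)" for \<phi>
  proof -
    have "linear_form W (\<theta>' h \<phi>)"
      using that h H_inv(2)[OF h]
      by (intro linear_formI)
        (simp_all add: \<theta>'_apply lin_mapsD[OF \<theta>] dual_space_carrier linear_form_def)
    then show ?thesis using that by (simp add: dual_space_carrier conjugate_rep_def)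
  qed
  show "\<theta>' h (\<phi> \<oplus>\<^bsub>dual_space W\<^esub> \<psi>) = \<theta>' h \<phi> \<oplus>\<^bsub>dual_space W\<^esub> \<theta>' h \<psi>"
    if "\<phi> \<in> carrier (dual_space W)" "\<psi> \<in> carrier (dual_space W)" for \<phi> \<psi>
    using that h H_inv(2)[OF h] by (intro dual_space_eqI) (simp_all add: cl \<theta>'_apply dual_space_apply)
  show "\<theta>' h (a \<odot>\<^bsub>dual_space W\<^esub> \<phi>) = a \<odot>\<^bsub>dual_space W\<^esub> \<theta>' h \<phi>"
    if "\<phi> \<in> carrier (dual_space W)" for a \<phi>
    using that h H_inv(2)[OF h] by (intro dual_space_eqI) (simp_all add: cl \<theta>'_apply dual_space_apply)
qed

lemma evaluation_linear_form:
  assumes "T \<in> lin_maps (V\<^sub>1 \<otimes>\<^sub>s V\<^sub>2 \<otimes>\<^sub>s W) L" "p \<in> carrier G \<times> carrier G"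
  shows "linear_form (V\<^sub>1 \<otimes>\<^sub>s V\<^sub>2 \<otimes>\<^sub>s W) (\<lambda>v. T v p)"
  using assms(2) by (intro linear_formI) (simp_all add: lin_mapsD[OF assms(1)] function_space_apply)

text \<open>
  The prescribed values are bilinear in \<open>(v\<^sub>1, v\<^sub>2)\<close> and linear in \<open>w\<close>, hence define a bilinear map into \<open>W'\<close>.
\<close>
lemma tilde_ex1:
  assumes T: "T \<in> lin_maps (V\<^sub>1 \<otimes>\<^sub>s V\<^sub>2 \<otimes>\<^sub>s W) L"
  shows "\<exists>!S. tilde_spec G V\<^sub>1 V\<^sub>2 W T S"
proof -
  note form = evaluation_linear_form[OF T, of "(\<one>, \<one>)", simplified]
  note lin = linear_form_add[OF form] linear_form_smult[OF form]
    V12W.pure_tensor_linear V2W.pure_tensor_linear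
  define b where "b x y = (\<lambda>w\<in>carrier W. \<kappa> * T (pure3 x y w) (\<one>, \<one>))" for x y
  have bD: "b x y \<in> carrier (dual_space W)" if "x \<in> carrier V\<^sub>1" "y \<in> carrier V\<^sub>2" for x y
    using that by (simp add: b_def dual_space_carrier linear_form_def lin algebra_simps)
  have "bilinear_map V\<^sub>1 V\<^sub>2 (dual_space W) b"
    unfolding bilinear_map_def
    by (auto intro!: lin_mapsI dual_space_eqI simp: bD)
      (simp_all add: b_def dual_space_apply lin algebra_simps)
  then obtain S where S: "S \<in> lin_maps (V\<^sub>1 \<otimes>\<^sub>s V\<^sub>2) (dual_space W)"
    and Sb: "\<And>x y. \<lbrakk>x \<in> carrier V\<^sub>1; y \<in> carrier V\<^sub>2\<rbrakk> \<Longrightarrow> S (pure_tensor V\<^sub>1 V\<^sub>2 x y) = b x y"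
    using V12.bilinear_extension[OF D.fd_inner_space_axioms] by blast
  have "tilde_spec G V\<^sub>1 V\<^sub>2 W T S" using S Sb by (simp add: tilde_spec_def b_def \<kappa>_def)
  moreover have "R = S" if R: "tilde_spec G V\<^sub>1 V\<^sub>2 W T R" for R
  proof (rule V12.tensor_lin_maps_eqI[OF D.fd_inner_space_axioms])
    show R': "R \<in> lin_maps (V\<^sub>1 \<otimes>\<^sub>s V\<^sub>2) (dual_space W)" using R by (simp add: tilde_spec_def)
    fix x y assume xy: "x \<in> carrier V\<^sub>1" "y \<in> carrier V\<^sub>2"
    show "R (pure_tensor V\<^sub>1 V\<^sub>2 x y) = S (pure_tensor V\<^sub>1 V\<^sub>2 x y)"
      using R \<open>tilde_spec G V\<^sub>1 V\<^sub>2 W T S\<close> xy lin_mapsD(2)[OF R'] lin_mapsD(2)[OF S]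
      by (intro dual_space_eqI) (simp_all add: tilde_spec_def)
  qed (rule S)
  ultimately show ?thesis by blast
qed

lemma tilde_unique:
  assumes "T \<in> lin_maps (V\<^sub>1 \<otimes>\<^sub>s V\<^sub>2 \<otimes>\<^sub>s W) L" "tilde_spec G V\<^sub>1 V\<^sub>2 W T S"
  shows "tilde G V\<^sub>1 V\<^sub>2 W T = S"
  unfolding tilde_def by (rule the1_equality[OF tilde_ex1[OF assms(1)], OF assms(2)])

lemma tilde:
  assumes "T \<in> lin_maps (V\<^sub>1 \<otimes>\<^sub>s V\<^sub>2 \<otimes>\<^sub>s W) L"
  shows "tilde G V\<^sub>1 V\<^sub>2 W T \<in> lin_maps (V\<^sub>1 \<otimes>\<^sub>s V\<^sub>2) (dual_space W)"
    and "\<lbrakk>x \<in> carrier V\<^sub>1; y \<in> carrier V\<^sub>2; w \<in> carrier W\<rbrakk>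
      \<Longrightarrow> tilde G V\<^sub>1 V\<^sub>2 W T (pure_tensor V\<^sub>1 V\<^sub>2 x y) w = \<kappa> * T (pure3 x y w) (\<one>, \<one>)"
  using theI'[OF tilde_ex1[OF assms]] by (auto simp: tilde_def tilde_spec_def \<kappa>_def)

lemma \<kappa>_inverse:
  "complex_of_real (sqrt (real (cdim W)) / real (card (carrier G))) = inverse \<kappa>"
  by (simp add: \<kappa>_def)

lemma \<kappa>_nonzero: "\<kappa> \<noteq> 0"
proof -
  have "card (carrier G) \<noteq> 0" using finite_group G.one_closed by auto
  then show ?thesis using R.cdim_nonzero by (simp add: \<kappa>_def)
qed

lemma hat_ex1:
  assumes S: "S \<in> lin_maps (V\<^sub>1 \<otimes>\<^sub>s V\<^sub>2) (dual_space W)"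
  shows "\<exists>!T. hat_spec G V\<^sub>1 \<rho>\<^sub>1 V\<^sub>2 \<rho>\<^sub>2 W S T"
proof -
  define t where "t x y z = (\<lambda>(g\<^sub>1, g\<^sub>2)\<in>carrier G \<times> carrier G. inverse \<kappa> *
      S (pure_tensor V\<^sub>1 V\<^sub>2 (\<rho>\<^sub>1 (inv g\<^sub>2 \<otimes> inv g\<^sub>1) x) (\<rho>\<^sub>2 (inv g\<^sub>2) y)) z)" for x y z
  have t: "t x y z (g\<^sub>1, g\<^sub>2) = inverse \<kappa> *
      S (pure_tensor V\<^sub>1 V\<^sub>2 (\<rho>\<^sub>1 (inv g\<^sub>2 \<otimes> inv g\<^sub>1) x) (\<rho>\<^sub>2 (inv g\<^sub>2) y)) z"
    if "g\<^sub>1 \<in> carrier G" "g\<^sub>2 \<in> carrier G" for x y z g\<^sub>1 g\<^sub>2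
    using that by (simp add: t_def)
  have tL: "t x y z \<in> carrier L" for x y z
    by (auto simp: t_def function_space_def)
  have Sz: "S q (z \<oplus>\<^bsub>W\<^esub> z') = S q z + S q z'" "S q (c \<odot>\<^bsub>W\<^esub> z) = c * S q z"
    if "q \<in> carrier (V\<^sub>1 \<otimes>\<^sub>s V\<^sub>2)" "z \<in> carrier W" "z' \<in> carrier W" for q z z' c
    using lin_mapsD(2)[OF S that(1)] that by (auto simp: dual_space_carrier linear_form_def)
  note lin = lin_mapsD(3,4)[OF S] lin_mapsD(3,4)[OF R1.linear] lin_mapsD(3,4)[OF R2.linear]
    V12.pure_tensor_linear dual_space_apply Sz function_space_apply
  have "(\<lambda>x\<in>carrier V\<^sub>1. t x y z) \<in> lin_maps V\<^sub>1 L" if "y \<in> carrier V\<^sub>2" "z \<in> carrier W" for y z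
    using that by (intro lin_mapsI function_space_eqI) (simp_all add: tL t lin algebra_simps)
  moreover have "bilinear_map V\<^sub>2 W L (t x)" if "x \<in> carrier V\<^sub>1" for x
    using that unfolding bilinear_map_def
    by (intro conjI ballI; intro lin_mapsI function_space_eqI) (simp_all add: tL t lin algebra_simps)
  ultimately obtain T where T: "T \<in> lin_maps (V\<^sub>1 \<otimes>\<^sub>s V\<^sub>2 \<otimes>\<^sub>s W) L"
    and Tt: "\<And>x y z. \<lbrakk>x \<in> carrier V\<^sub>1; y \<in> carrier V\<^sub>2; z \<in> carrier W\<rbrakk> \<Longrightarrow> T (pure3 x y z) = t x y z"
    using trilinear_extension[OF L.fd_inner_space_axioms, of t] by blast
  have spec: "hat_spec G V\<^sub>1 \<rho>\<^sub>1 V\<^sub>2 \<rho>\<^sub>2 W S T"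
    using T unfolding hat_spec_def \<kappa>_inverse by (simp add: Tt t)
  moreover have "R = T" if R: "hat_spec G V\<^sub>1 \<rho>\<^sub>1 V\<^sub>2 \<rho>\<^sub>2 W S R" for R
  proof (rule triple_lin_maps_eqI[OF L.fd_inner_space_axioms])
    show R': "R \<in> lin_maps (V\<^sub>1 \<otimes>\<^sub>s V\<^sub>2 \<otimes>\<^sub>s W) L" using R by (simp add: hat_spec_def)
    fix x y z assume xyz: "x \<in> carrier V\<^sub>1" "y \<in> carrier V\<^sub>2" "z \<in> carrier W"
    show "R (pure3 x y z) = T (pure3 x y z)"
      using R spec xyz lin_mapsD(2)[OF R'] lin_mapsD(2)[OF T]
      by (intro function_space_eqI) (simp_all add: hat_spec_def)
  qed (rule T)
  ultimately show ?thesis by blast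
qed

lemma hat_unique:
  assumes "S \<in> lin_maps (V\<^sub>1 \<otimes>\<^sub>s V\<^sub>2) (dual_space W)" "hat_spec G V\<^sub>1 \<rho>\<^sub>1 V\<^sub>2 \<rho>\<^sub>2 W S T"
  shows "hat G V\<^sub>1 \<rho>\<^sub>1 V\<^sub>2 \<rho>\<^sub>2 W S = T"
  unfolding hat_def by (rule the1_equality[OF hat_ex1[OF assms(1)], OF assms(2)])

lemma hat:
  assumes "S \<in> lin_maps (V\<^sub>1 \<otimes>\<^sub>s V\<^sub>2) (dual_space W)"
  shows "hat G V\<^sub>1 \<rho>\<^sub>1 V\<^sub>2 \<rho>\<^sub>2 W S \<in> lin_maps (V\<^sub>1 \<otimes>\<^sub>s V\<^sub>2 \<otimes>\<^sub>s W) L"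
    and "\<lbrakk>x \<in> carrier V\<^sub>1; y \<in> carrier V\<^sub>2; w \<in> carrier W; g\<^sub>1 \<in> carrier G; g\<^sub>2 \<in> carrier G\<rbrakk>
      \<Longrightarrow> hat G V\<^sub>1 \<rho>\<^sub>1 V\<^sub>2 \<rho>\<^sub>2 W S (pure3 x y w) (g\<^sub>1, g\<^sub>2) = inverse \<kappa> *
          S (pure_tensor V\<^sub>1 V\<^sub>2 (\<rho>\<^sub>1 (inv g\<^sub>2 \<otimes> inv g\<^sub>1) x) (\<rho>\<^sub>2 (inv g\<^sub>2) y)) w"
proof -
  have "hat_spec G V\<^sub>1 \<rho>\<^sub>1 V\<^sub>2 \<rho>\<^sub>2 W S (hat G V\<^sub>1 \<rho>\<^sub>1 V\<^sub>2 \<rho>\<^sub>2 W S)"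
    unfolding hat_def by (rule theI'[OF hat_ex1[OF assms]])
  then show "hat G V\<^sub>1 \<rho>\<^sub>1 V\<^sub>2 \<rho>\<^sub>2 W S \<in> lin_maps (V\<^sub>1 \<otimes>\<^sub>s V\<^sub>2 \<otimes>\<^sub>s W) L"
    and "\<lbrakk>x \<in> carrier V\<^sub>1; y \<in> carrier V\<^sub>2; w \<in> carrier W; g\<^sub>1 \<in> carrier G; g\<^sub>2 \<in> carrier G\<rbrakk>
      \<Longrightarrow> hat G V\<^sub>1 \<rho>\<^sub>1 V\<^sub>2 \<rho>\<^sub>2 W S (pure3 x y w) (g\<^sub>1, g\<^sub>2) = inverse \<kappa> *
          S (pure_tensor V\<^sub>1 V\<^sub>2 (\<rho>\<^sub>1 (inv g\<^sub>2 \<otimes> inv g\<^sub>1) x) (\<rho>\<^sub>2 (inv g\<^sub>2) y)) w"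
    unfolding hat_spec_def \<kappa>_inverse by blast+
qed

text \<open>
  Transitivity: the action of \<open>(g\<^sub>2\<^bsup>-1\<^esup> g\<^sub>1\<^bsup>-1\<^esup>, g\<^sub>2\<^bsup>-1\<^esup>, 1)\<close> moves \<open>(g\<^sub>1, g\<^sub>2)\<close> to \<open>(1, 1)\<close>. The right-hand side has
  the shape of the formula that defines \<^const>\<open>hat\<close>.
\<close>
lemma value_by_translation:
  assumes T: "T \<in> carrier X" and xyz: "x \<in> carrier V\<^sub>1" "y \<in> carrier V\<^sub>2" "z \<in> carrier W"
    and g: "g\<^sub>1 \<in> carrier G" "g\<^sub>2 \<in> carrier G"
  shows "T (pure3 x y z) (g\<^sub>1, g\<^sub>2) = T (pure3 (\<rho>\<^sub>1 (inv g\<^sub>2 \<otimes> inv g\<^sub>1) x) (\<rho>\<^sub>2 (inv g\<^sub>2) y) z) (\<one>, \<one>)"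
proof -
  have one: "\<one> \<in> H" using subgroup.one_closed[OF subgroup] .
  have TL: "T (pure3 x y z) \<in> carrier L"
    using T xyz lin_mapsD(2)[of T "V\<^sub>1 \<otimes>\<^sub>s V\<^sub>2 \<otimes>\<^sub>s W" L] by (simp add: in_X_iff)
  have "T (\<sigma> (inv g\<^sub>2 \<otimes> inv g\<^sub>1, inv g\<^sub>2, \<one>) (pure3 x y z))
      = eta G (inv g\<^sub>2 \<otimes> inv g\<^sub>1, inv g\<^sub>2, \<one>) (T (pure3 x y z))"
    using T g one xyz by (simp add: in_X_iff)
  moreover have "\<sigma> (inv g\<^sub>2 \<otimes> inv g\<^sub>1, inv g\<^sub>2, \<one>) (pure3 x y z)
      = pure3 (\<rho>\<^sub>1 (inv g\<^sub>2 \<otimes> inv g\<^sub>1) x) (\<rho>\<^sub>2 (inv g\<^sub>2) y) z"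
    using \<sigma>_pure(2)[OF _ _ one xyz] g xyz by simp
  moreover have "eta G (inv g\<^sub>2 \<otimes> inv g\<^sub>1, inv g\<^sub>2, \<one>) (T (pure3 x y z)) (\<one>, \<one>) = T (pure3 x y z) (g\<^sub>1, g\<^sub>2)"
    using g by (simp add: eta_apply[OF TL] G.inv_mult_group G.m_assoc)
  ultimately show ?thesis by simp
qed

text \<open>
  The element \<open>(h, h, h)\<close> fixes the point \<open>(1, 1)\<close>, so that \<open>v \<mapsto> (T v)(1, 1)\<close> is invariant under the diagonal
  action of \<open>H\<close>. Moving the action on \<open>W\<close> to the other side produces \<open>\<theta>'\<close>.
\<close>
lemma tilde_intertwines:
  assumes T: "T \<in> carrier X"
  shows "tilde G V\<^sub>1 V\<^sub>2 W T \<in> carrier Y"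
proof -
  let ?S = "tilde G V\<^sub>1 V\<^sub>2 W T"
  have TL: "T \<in> lin_maps (V\<^sub>1 \<otimes>\<^sub>s V\<^sub>2 \<otimes>\<^sub>s W) L" using T by (simp add: in_X_iff)
  note S = tilde[OF TL]
  have "?S (\<tau> h v) = \<theta>' h (?S v)" if h: "h \<in> H" and v: "v \<in> carrier (V\<^sub>1 \<otimes>\<^sub>s V\<^sub>2)" for h v
  proof -
    note hG = H_carrier[OF h]
    have "(\<lambda>v\<in>carrier (V\<^sub>1 \<otimes>\<^sub>s V\<^sub>2). ?S (\<tau> h v)) = (\<lambda>v\<in>carrier (V\<^sub>1 \<otimes>\<^sub>s V\<^sub>2). \<theta>' h (?S v))"
    proof (rule V12.tensor_lin_maps_eqI[OF D.fd_inner_space_axioms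
          lin_maps_compose[OF \<tau>_pure(1)[OF h] S(1) T12.vectorspace_axioms]
          lin_maps_compose[OF S(1) \<theta>'_linear[OF h] T12.vectorspace_axioms]])
      fix x y assume x: "x \<in> carrier V\<^sub>1" and y: "y \<in> carrier V\<^sub>2"
      have "?S (pure_tensor V\<^sub>1 V\<^sub>2 (\<rho>\<^sub>1 h x) (\<rho>\<^sub>2 h y)) = \<theta>' h (?S (pure_tensor V\<^sub>1 V\<^sub>2 x y))"
      proof (rule dual_space_eqI)
        fix w assume w: "w \<in> carrier W"
        let ?w = "\<theta> (inv h) w"
        have w': "?w \<in> carrier W" using w H_inv(2)[OF h] by simp
        have TD: "T (pure3 x y ?w) \<in> carrier L" using x y w' lin_mapsD(2)[OF TL] by simp
        have "T (pure3 (\<rho>\<^sub>1 h x) (\<rho>\<^sub>2 h y) w) (\<one>, \<one>) = T (\<sigma> (h, h, h) (pure3 x y ?w)) (\<one>, \<one>)"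
          using \<sigma>_pure(2)[OF hG hG h x y w'] \<theta>_inverse[OF h w] by simp
        also have "\<dots> = eta G (h, h, h) (T (pure3 x y ?w)) (\<one>, \<one>)"
          using T h hG x y w' by (simp add: in_X_iff)
        also have "\<dots> = T (pure3 x y ?w) (\<one>, \<one>)"
          using hG by (simp add: eta_apply[OF TD])
        finally show "?S (pure_tensor V\<^sub>1 V\<^sub>2 (\<rho>\<^sub>1 h x) (\<rho>\<^sub>2 h y)) w = \<theta>' h (?S (pure_tensor V\<^sub>1 V\<^sub>2 x y)) w"
          using x y w w' hG h lin_mapsD(2)[OF S(1)] by (simp add: S(2) \<theta>'_apply)
      qed (use x y hG h lin_mapsD(2)[OF S(1)] lin_mapsD(2)[OF \<theta>'_linear[OF h]] in auto)
      then show "(\<lambda>v\<in>carrier (V\<^sub>1 \<otimes>\<^sub>s V\<^sub>2). ?S (\<tau> h v)) (pure_tensor V\<^sub>1 V\<^sub>2 x y)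
          = (\<lambda>v\<in>carrier (V\<^sub>1 \<otimes>\<^sub>s V\<^sub>2). \<theta>' h (?S v)) (pure_tensor V\<^sub>1 V\<^sub>2 x y)"
        using x y \<tau>_pure(2)[OF h] by simp
    qed
    from fun_cong[OF this, of v] v show ?thesis by simp
  qed
  then show ?thesis using S(1) by (simp add: in_Y_iff)
qed

text \<open>
  The action of \<open>h\<close> on \<open>W\<close> is turned into that of \<open>h\<^bsup>-1\<^esup>\<close> on \<open>V\<^sub>1 \<otimes> V\<^sub>2\<close> by the intertwining property of \<open>S\<close>.
  What remains is that both sides translate \<open>x\<close> and \<open>y\<close> by the same group elements.
\<close>
lemma hat_intertwines:
  assumes S: "S \<in> carrier Y"
  shows "hat G V\<^sub>1 \<rho>\<^sub>1 V\<^sub>2 \<rho>\<^sub>2 W S \<in> carrier X"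
proof -
  let ?T = "hat G V\<^sub>1 \<rho>\<^sub>1 V\<^sub>2 \<rho>\<^sub>2 W S"
  have SL: "S \<in> lin_maps (V\<^sub>1 \<otimes>\<^sub>s V\<^sub>2) (dual_space W)" using S by (simp add: in_Y_iff)
  note T = hat[OF SL]
  have "?T (\<sigma> (a, b, h) v) = eta G (a, b, h) (?T v)"
    if ab: "a \<in> carrier G" "b \<in> carrier G" and h: "h \<in> H" and v: "v \<in> carrier (V\<^sub>1 \<otimes>\<^sub>s V\<^sub>2 \<otimes>\<^sub>s W)" for a b h v
  proof -
    note hG = H_carrier[OF h]
    have "(\<lambda>v\<in>carrier (V\<^sub>1 \<otimes>\<^sub>s V\<^sub>2 \<otimes>\<^sub>s W). ?T (\<sigma> (a, b, h) v))
        = (\<lambda>v\<in>carrier (V\<^sub>1 \<otimes>\<^sub>s V\<^sub>2 \<otimes>\<^sub>s W). eta G (a, b, h) (?T v))"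
    proof (rule triple_lin_maps_eqI[OF L.fd_inner_space_axioms
          lin_maps_compose[OF \<sigma>_pure(1)[OF ab h] T(1) T12W.vectorspace_axioms]
          lin_maps_compose[OF T(1) eta_linear[OF ab h] T12W.vectorspace_axioms]])
      fix x y z assume x: "x \<in> carrier V\<^sub>1" and y: "y \<in> carrier V\<^sub>2" and z: "z \<in> carrier W"
      have TD: "?T (pure3 x y z) \<in> carrier L" using x y z lin_mapsD(2)[OF T(1)] by simp
      have "?T (pure3 (\<rho>\<^sub>1 a x) (\<rho>\<^sub>2 b y) (\<theta> h z)) = eta G (a, b, h) (?T (pure3 x y z))"
      proof (rule function_space_eqI)
        fix g\<^sub>1 g\<^sub>2 assume g: "g\<^sub>1 \<in> carrier G" "g\<^sub>2 \<in> carrier G"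
        let ?x = "\<rho>\<^sub>1 (inv g\<^sub>2 \<otimes> inv g\<^sub>1 \<otimes> a) x" and ?y = "\<rho>\<^sub>2 (inv g\<^sub>2 \<otimes> b) y"
        have xy: "?x \<in> carrier V\<^sub>1" "?y \<in> carrier V\<^sub>2" using x y g ab by simp_all
        have "?T (pure3 (\<rho>\<^sub>1 a x) (\<rho>\<^sub>2 b y) (\<theta> h z)) (g\<^sub>1, g\<^sub>2)
            = inverse \<kappa> * S (pure_tensor V\<^sub>1 V\<^sub>2 ?x ?y) (\<theta> h z)"
          using x y z g ab h
          by (simp add: T(2) R1.composition_rule R2.composition_rule)
        also have "S (pure_tensor V\<^sub>1 V\<^sub>2 ?x ?y) (\<theta> h z) = \<theta>' (inv h) (S (pure_tensor V\<^sub>1 V\<^sub>2 ?x ?y)) z"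
          using xy z h hG H_inv(2)[OF h] lin_mapsD(2)[OF SL] by (simp add: \<theta>'_apply)
        also have "\<theta>' (inv h) (S (pure_tensor V\<^sub>1 V\<^sub>2 ?x ?y))
            = S (pure_tensor V\<^sub>1 V\<^sub>2 (\<rho>\<^sub>1 (inv h) ?x) (\<rho>\<^sub>2 (inv h) ?y))"
          unfolding \<tau>_pure(2)[OF H_inv(2)[OF h] xy, symmetric]
          using S xy H_inv(2)[OF h] by (simp add: in_Y_iff)
        also have "\<rho>\<^sub>1 (inv h) ?x = \<rho>\<^sub>1 (inv (inv b \<otimes> g\<^sub>2 \<otimes> h) \<otimes> inv (inv a \<otimes> g\<^sub>1 \<otimes> b)) x"
        proof -
          have "inv (inv b \<otimes> g\<^sub>2 \<otimes> h) \<otimes> inv (inv a \<otimes> g\<^sub>1 \<otimes> b)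
              = inv h \<otimes> (inv g\<^sub>2 \<otimes> (b \<otimes> (inv b \<otimes> (inv g\<^sub>1 \<otimes> a))))"
            using g ab hG by (simp add: G.inv_mult_group G.m_assoc)
          also have "b \<otimes> (inv b \<otimes> (inv g\<^sub>1 \<otimes> a)) = inv g\<^sub>1 \<otimes> a"
            using g ab by (simp flip: G.m_assoc)
          finally show ?thesis
            using x g ab hG R1.composition_rule[of x "inv h" "inv g\<^sub>2 \<otimes> inv g\<^sub>1 \<otimes> a"]
            by (simp add: G.m_assoc)
        qed
        also have "\<rho>\<^sub>2 (inv h) ?y = \<rho>\<^sub>2 (inv (inv b \<otimes> g\<^sub>2 \<otimes> h)) y"
          using y g ab hG R2.composition_rule[of y "inv h" "inv g\<^sub>2 \<otimes> b"]
          by (simp add: G.inv_mult_group G.m_assoc)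
        finally show "?T (pure3 (\<rho>\<^sub>1 a x) (\<rho>\<^sub>2 b y) (\<theta> h z)) (g\<^sub>1, g\<^sub>2)
            = eta G (a, b, h) (?T (pure3 x y z)) (g\<^sub>1, g\<^sub>2)"
          using x y z g ab hG by (simp add: T(2) eta_apply[OF TD])
      qed (use x y z ab h lin_mapsD(2)[OF T(1)] lin_mapsD(2)[OF eta_linear[OF ab h] TD] in auto)
      then show "(\<lambda>v\<in>carrier (V\<^sub>1 \<otimes>\<^sub>s V\<^sub>2 \<otimes>\<^sub>s W). ?T (\<sigma> (a, b, h) v)) (pure3 x y z)
          = (\<lambda>v\<in>carrier (V\<^sub>1 \<otimes>\<^sub>s V\<^sub>2 \<otimes>\<^sub>s W). eta G (a, b, h) (?T v)) (pure3 x y z)"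
        using x y z \<sigma>_pure(2)[OF ab h] by simp
    qed
    from fun_cong[OF this, of v] v show ?thesis by simp
  qed
  then show ?thesis using T(1) by (simp add: in_X_iff)
qed

lemma hat_tilde:
  assumes T: "T \<in> carrier X"
  shows "hat G V\<^sub>1 \<rho>\<^sub>1 V\<^sub>2 \<rho>\<^sub>2 W (tilde G V\<^sub>1 V\<^sub>2 W T) = T"
proof -
  have TL: "T \<in> lin_maps (V\<^sub>1 \<otimes>\<^sub>s V\<^sub>2 \<otimes>\<^sub>s W) L" using T by (simp add: in_X_iff)
  show ?thesis
  proof (rule hat_unique[OF tilde(1)[OF TL]])
    have "T (pure3 x y z) (g\<^sub>1, g\<^sub>2) = inverse \<kappa> * tilde G V\<^sub>1 V\<^sub>2 W T
        (pure_tensor V\<^sub>1 V\<^sub>2 (\<rho>\<^sub>1 (inv g\<^sub>2 \<otimes> inv g\<^sub>1) x) (\<rho>\<^sub>2 (inv g\<^sub>2) y)) z"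
      if "x \<in> carrier V\<^sub>1" "y \<in> carrier V\<^sub>2" "z \<in> carrier W" "g\<^sub>1 \<in> carrier G" "g\<^sub>2 \<in> carrier G"
      for x y z g\<^sub>1 g\<^sub>2
      using that \<kappa>_nonzero by (subst value_by_translation[OF T that]) (simp add: tilde(2)[OF TL])
    then show "hat_spec G V\<^sub>1 \<rho>\<^sub>1 V\<^sub>2 \<rho>\<^sub>2 W (tilde G V\<^sub>1 V\<^sub>2 W T) T"
      unfolding hat_spec_def \<kappa>_inverse using TL by blast
  qed
qed

lemma tilde_hat:
  assumes S: "S \<in> carrier Y"
  shows "tilde G V\<^sub>1 V\<^sub>2 W (hat G V\<^sub>1 \<rho>\<^sub>1 V\<^sub>2 \<rho>\<^sub>2 W S) = S"
proof -
  have SL: "S \<in> lin_maps (V\<^sub>1 \<otimes>\<^sub>s V\<^sub>2) (dual_space W)" using S by (simp add: in_Y_iff)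
  show ?thesis
  proof (rule tilde_unique[OF hat(1)[OF SL]])
    show "tilde_spec G V\<^sub>1 V\<^sub>2 W (hat G V\<^sub>1 \<rho>\<^sub>1 V\<^sub>2 \<rho>\<^sub>2 W S) S"
      unfolding tilde_spec_def \<kappa>_def[symmetric]
      using SL \<kappa>_nonzero by (simp add: hat(2)[OF SL])
  qed
qed

lemma tilde_linear: "tilde G V\<^sub>1 V\<^sub>2 W \<in> LinearCombinations.module_hom CC X Y"
proof -
  have add: "tilde G V\<^sub>1 V\<^sub>2 W (S \<oplus>\<^bsub>hom_space (V\<^sub>1 \<otimes>\<^sub>s V\<^sub>2 \<otimes>\<^sub>s W) L\<^esub> T)
      = tilde G V\<^sub>1 V\<^sub>2 W S \<oplus>\<^bsub>hom_space (V\<^sub>1 \<otimes>\<^sub>s V\<^sub>2) (dual_space W)\<^esub> tilde G V\<^sub>1 V\<^sub>2 W T"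
    if S: "S \<in> lin_maps (V\<^sub>1 \<otimes>\<^sub>s V\<^sub>2 \<otimes>\<^sub>s W) L" and T: "T \<in> lin_maps (V\<^sub>1 \<otimes>\<^sub>s V\<^sub>2 \<otimes>\<^sub>s W) L" for S T
  proof (rule tilde_unique[OF XL.lin_maps_add[OF S T]])
    show "tilde_spec G V\<^sub>1 V\<^sub>2 W (S \<oplus>\<^bsub>hom_space (V\<^sub>1 \<otimes>\<^sub>s V\<^sub>2 \<otimes>\<^sub>s W) L\<^esub> T)
        (tilde G V\<^sub>1 V\<^sub>2 W S \<oplus>\<^bsub>hom_space (V\<^sub>1 \<otimes>\<^sub>s V\<^sub>2) (dual_space W)\<^esub> tilde G V\<^sub>1 V\<^sub>2 W T)"
      unfolding tilde_spec_def \<kappa>_def[symmetric]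
      using YD.lin_maps_add[OF tilde(1)[OF S] tilde(1)[OF T]]
      by (simp add: hom_space_apply dual_space_apply function_space_apply tilde(2)[OF S] tilde(2)[OF T] algebra_simps)
  qed
  have smult: "tilde G V\<^sub>1 V\<^sub>2 W (a \<odot>\<^bsub>hom_space (V\<^sub>1 \<otimes>\<^sub>s V\<^sub>2 \<otimes>\<^sub>s W) L\<^esub> T)
      = a \<odot>\<^bsub>hom_space (V\<^sub>1 \<otimes>\<^sub>s V\<^sub>2) (dual_space W)\<^esub> tilde G V\<^sub>1 V\<^sub>2 W T"
    if T: "T \<in> lin_maps (V\<^sub>1 \<otimes>\<^sub>s V\<^sub>2 \<otimes>\<^sub>s W) L" for a T
  proof (rule tilde_unique[OF XL.lin_maps_smult[OF T]])
    show "tilde_spec G V\<^sub>1 V\<^sub>2 W (a \<odot>\<^bsub>hom_space (V\<^sub>1 \<otimes>\<^sub>s V\<^sub>2 \<otimes>\<^sub>s W) L\<^esub> T)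
        (a \<odot>\<^bsub>hom_space (V\<^sub>1 \<otimes>\<^sub>s V\<^sub>2) (dual_space W)\<^esub> tilde G V\<^sub>1 V\<^sub>2 W T)"
      unfolding tilde_spec_def \<kappa>_def[symmetric]
      using YD.lin_maps_smult[OF tilde(1)[OF T]]
      by (simp add: hom_space_apply dual_space_apply function_space_apply tilde(2)[OF T] algebra_simps)
  qed
  have X: "T \<in> lin_maps (V\<^sub>1 \<otimes>\<^sub>s V\<^sub>2 \<otimes>\<^sub>s W) L" if "T \<in> carrier X" for T
    using that by (simp add: in_X_iff)
  have ops: "S \<oplus>\<^bsub>intertwiners \<Gamma> V \<alpha> U \<beta>\<^esub> T = S \<oplus>\<^bsub>hom_space V U\<^esub> T"
      "a \<odot>\<^bsub>intertwiners \<Gamma> V \<alpha> U \<beta>\<^esub> T = a \<odot>\<^bsub>hom_space V U\<^esub> T" for \<Gamma> V \<alpha> U \<beta> S T a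
    by (simp_all add: intertwiners_def)
  show ?thesis
    unfolding LinearCombinations.module_hom_def ops
    using tilde_intertwines add[OF X X] smult[OF X] by auto
qed

text \<open>
  At each of the \<open>|G|\<^sup>2\<close> points \<open>(g\<^sub>1, g\<^sub>2)\<close>, the translation formula replaces the bases \<open>E\<close> and \<open>F\<close> by their
  images under \<open>\<rho>\<^sub>1 (g\<^sub>2\<^bsup>-1\<^esup> g\<^sub>1\<^bsup>-1\<^esup>)\<close> and \<open>\<rho>\<^sub>2 (g\<^sub>2\<^bsup>-1\<^esup>)\<close> and the point by \<open>(1, 1)\<close>. As the sum over an
  orthonormal basis of the triple tensor product does not depend on the basis, all points contribute equally.
\<close>
lemma cinner_X:
  assumes S: "S \<in> carrier X" and T: "T \<in> carrier X"
    and E: "orthonormal_basis V\<^sub>1 E" and F: "orthonormal_basis V\<^sub>2 F" and K: "orthonormal_basis W K"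
  shows "cinner X S T = (of_nat (card (carrier G)))\<^sup>2 *
      (\<Sum>e\<in>E. \<Sum>f\<in>F. \<Sum>k\<in>K. S (pure3 e f k) (\<one>, \<one>) * cnj (T (pure3 e f k) (\<one>, \<one>))) /
      of_nat (cdim V\<^sub>1 * cdim V\<^sub>2 * cdim W)"
proof -
  define N where "N = (\<Sum>e\<in>E. \<Sum>f\<in>F. \<Sum>k\<in>K. S (pure3 e f k) (\<one>, \<one>) * cnj (T (pure3 e f k) (\<one>, \<one>)))"
  have SL: "S \<in> lin_maps (V\<^sub>1 \<otimes>\<^sub>s V\<^sub>2 \<otimes>\<^sub>s W) L" and TL: "T \<in> lin_maps (V\<^sub>1 \<otimes>\<^sub>s V\<^sub>2 \<otimes>\<^sub>s W) L"
    using S T by (simp_all add: in_X_iff)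
  note Ec = R1.orthonormal_basis_carrier[OF E] and Fc = R2.orthonormal_basis_carrier[OF F]
    and Kc = R.orthonormal_basis_carrier[OF K]
  obtain D where D: "orthonormal_basis (V\<^sub>1 \<otimes>\<^sub>s V\<^sub>2 \<otimes>\<^sub>s W) D"
    and sumD: "\<And>h. (\<Sum>d\<in>D. h d) = (\<Sum>e\<in>E. \<Sum>f\<in>F. \<Sum>k\<in>K. h (pure3 e f k) :: complex)"
    using sum_triple_basis[OF E F K] by blast
  have shift: "(\<Sum>d\<in>D. S d (g\<^sub>1, g\<^sub>2) * cnj (T d (g\<^sub>1, g\<^sub>2))) = N"
    if g: "g\<^sub>1 \<in> carrier G" "g\<^sub>2 \<in> carrier G" for g\<^sub>1 g\<^sub>2
  proof -
    let ?a = "inv g\<^sub>2 \<otimes> inv g\<^sub>1" and ?b = "inv g\<^sub>2"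
    have ab: "?a \<in> carrier G" "?b \<in> carrier G" using g by simp_all
    note E' = R1.image_orthonormal_basis[OF E ab(1)] and F' = R2.image_orthonormal_basis[OF F ab(2)]
    obtain D' where D': "orthonormal_basis (V\<^sub>1 \<otimes>\<^sub>s V\<^sub>2 \<otimes>\<^sub>s W) D'"
      and sumD': "\<And>h. (\<Sum>d\<in>D'. h d)
        = (\<Sum>e\<in>\<rho>\<^sub>1 ?a ` E. \<Sum>f\<in>\<rho>\<^sub>2 ?b ` F. \<Sum>k\<in>K. h (pure3 e f k) :: complex)"
      using sum_triple_basis[OF E'(1) F'(1) K] by blast
    have "(\<Sum>d\<in>D. S d (g\<^sub>1, g\<^sub>2) * cnj (T d (g\<^sub>1, g\<^sub>2)))
        = (\<Sum>d\<in>D'. S d (\<one>, \<one>) * cnj (T d (\<one>, \<one>)))"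
      unfolding sumD sumD' sum.reindex[OF E'(2)] sum.reindex[OF F'(2)]
      using Ec Fc Kc by (simp add: value_by_translation[OF S _ _ _ g] value_by_translation[OF T _ _ _ g])
    also have "\<dots> = (\<Sum>d\<in>D. S d (\<one>, \<one>) * cnj (T d (\<one>, \<one>)))"
      by (rule T12W.sum_orthonormal_basis_independent[OF D' D])
        (use evaluation_linear_form[OF SL] evaluation_linear_form[OF TL] in simp_all)
    also have "\<dots> = N" by (simp add: sumD N_def)
    finally show ?thesis .
  qed
  have "(\<Sum>d\<in>D. cinner L (S d) (T d))
      = (\<Sum>d\<in>D. \<Sum>p\<in>carrier G \<times> carrier G. S d p * cnj (T d p))"
    by (simp add: function_space_def)
  also have "\<dots> = (\<Sum>p\<in>carrier G \<times> carrier G. \<Sum>d\<in>D. S d p * cnj (T d p))"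
    by (rule sum.swap)
  also have "\<dots> = (\<Sum>p\<in>carrier G \<times> carrier G. N)"
    by (intro sum.cong) (auto simp: shift)
  also have "\<dots> = (of_nat (card (carrier G)))\<^sup>2 * N"
    by (simp add: card_cartesian_product power2_eq_square)
  finally show ?thesis
    using XL.cinner_hom_space[OF D SL TL]
    by (simp add: intertwiners_def N_def V12W.cdim_tensor V2W.cdim_tensor mult.assoc)
qed

text \<open>
  Here \<open>|\<kappa>|\<^sup>2 = |G|\<^sup>2 / d\<^sub>\<theta>\<close> makes up for the \<open>|G|\<^sup>2\<close> equal contributions and for the factor by which the
  normalizations \<open>1 / (d\<^sub>1 d\<^sub>2 d\<^sub>\<theta>)\<close> and \<open>1 / (d\<^sub>1 d\<^sub>2)\<close> differ.
\<close>
lemma tilde_isometric: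
  assumes S: "S \<in> carrier X" and T: "T \<in> carrier X"
  shows "cinner Y (tilde G V\<^sub>1 V\<^sub>2 W S) (tilde G V\<^sub>1 V\<^sub>2 W T) = cinner X S T"
proof -
  obtain E F K where E: "orthonormal_basis V\<^sub>1 E" and F: "orthonormal_basis V\<^sub>2 F" and K: "orthonormal_basis W K"
    using R1.orthonormal_basis_exists R2.orthonormal_basis_exists R.orthonormal_basis_exists by blast
  note Ec = R1.orthonormal_basis_carrier[OF E] and Fc = R2.orthonormal_basis_carrier[OF F]
    and Kc = R.orthonormal_basis_carrier[OF K]
  define N where "N = (\<Sum>e\<in>E. \<Sum>f\<in>F. \<Sum>k\<in>K. S (pure3 e f k) (\<one>, \<one>) * cnj (T (pure3 e f k) (\<one>, \<one>)))"
  have SL: "S \<in> lin_maps (V\<^sub>1 \<otimes>\<^sub>s V\<^sub>2 \<otimes>\<^sub>s W) L" and TL: "T \<in> lin_maps (V\<^sub>1 \<otimes>\<^sub>s V\<^sub>2 \<otimes>\<^sub>s W) L"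
    using S T by (simp_all add: in_X_iff)
  note S' = tilde[OF SL] and T' = tilde[OF TL]
  have dual: "cinner (dual_space W) (tilde G V\<^sub>1 V\<^sub>2 W S q) (tilde G V\<^sub>1 V\<^sub>2 W T q)
      = (\<Sum>k\<in>K. tilde G V\<^sub>1 V\<^sub>2 W S q k * cnj (tilde G V\<^sub>1 V\<^sub>2 W T q k))"
    if "q \<in> carrier (V\<^sub>1 \<otimes>\<^sub>s V\<^sub>2)" for q
    using lin_mapsD(2)[OF S'(1) that] lin_mapsD(2)[OF T'(1) that]
    by (intro R.cinner_dual_space[OF K]) (simp_all add: dual_space_carrier)
  have \<kappa>: "\<kappa> * cnj \<kappa> = (of_nat (card (carrier G)))\<^sup>2 / of_nat (cdim W)"
    by (simp add: \<kappa>_def power2_eq_square flip: of_real_mult)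
  have "cinner Y (tilde G V\<^sub>1 V\<^sub>2 W S) (tilde G V\<^sub>1 V\<^sub>2 W T)
      = (\<Sum>e\<in>E. \<Sum>f\<in>F. \<Sum>k\<in>K. (\<kappa> * cnj \<kappa>) *
          (S (pure3 e f k) (\<one>, \<one>) * cnj (T (pure3 e f k) (\<one>, \<one>)))) / of_nat (cdim V\<^sub>1 * cdim V\<^sub>2)"
    using Ec Fc Kc YD.cinner_hom_space[OF V12.tensor_basis(2)[OF E F] S'(1) T'(1)]
    by (simp add: intertwiners_def V12.sum_tensor_basis[OF E F] dual S'(2) T'(2) V12.cdim_tensor mult_ac)
  also have "\<dots> = (\<kappa> * cnj \<kappa>) * N / of_nat (cdim V\<^sub>1 * cdim V\<^sub>2)"
    by (simp add: N_def sum_distrib_left)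
  also have "\<dots> = cinner X S T"
    unfolding cinner_X[OF S T E F K] \<kappa> N_def by (simp add: mult_ac)
  finally show ?thesis .
qed

lemma tilde_isometric_iso: "isometric_iso X Y (tilde G V\<^sub>1 V\<^sub>2 W)"
proof -
  have "bij_betw (tilde G V\<^sub>1 V\<^sub>2 W) (carrier X) (carrier Y)"
    by (rule bij_betw_byWitness[where f' = "hat G V\<^sub>1 \<rho>\<^sub>1 V\<^sub>2 \<rho>\<^sub>2 W"])
      (use hat_tilde tilde_hat tilde_intertwines hat_intertwines in blast)+
  then show ?thesis using tilde_linear tilde_isometric by (simp add: isometric_iso_def)
qed

end

theorem theorem3p1:
  fixes G :: "('g, 'm) monoid_scheme" and H :: "'g set"
    and V\<^sub>1 :: "'a ip_space" and \<rho>\<^sub>1 :: "'g \<Rightarrow> 'a \<Rightarrow> 'a"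
    and V\<^sub>2 :: "'b ip_space" and \<rho>\<^sub>2 :: "'g \<Rightarrow> 'b \<Rightarrow> 'b"
    and W :: "'w ip_space" and \<theta> :: "'g \<Rightarrow> 'w \<Rightarrow> 'w"
  assumes "group G" and "finite (carrier G)" and "subgroup H G"
    and "irreducible_rep G V\<^sub>1 \<rho>\<^sub>1" and "irreducible_rep G V\<^sub>2 \<rho>\<^sub>2"
    and "unitary_rep (G\<lparr>carrier := H\<rparr>) W \<theta>"
  shows
    "let X = intertwiners (G \<times>\<times> G \<times>\<times> G\<lparr>carrier := H\<rparr>)
               (V\<^sub>1 \<otimes>\<^sub>s V\<^sub>2 \<otimes>\<^sub>s W)
               (outer_tensor_rep V\<^sub>1 (V\<^sub>2 \<otimes>\<^sub>s W) \<rho>\<^sub>1 (outer_tensor_rep V\<^sub>2 W \<rho>\<^sub>2 \<theta>))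
               (function_space (carrier G \<times> carrier G)) (eta G);
         Y = intertwiners (G\<lparr>carrier := H\<rparr>)
               (V\<^sub>1 \<otimes>\<^sub>s V\<^sub>2) (inner_tensor_rep V\<^sub>1 V\<^sub>2 \<rho>\<^sub>1 \<rho>\<^sub>2)
               (dual_space W) (conjugate_rep (G\<lparr>carrier := H\<rparr>) W \<theta>)
     in (\<forall>T\<in>carrier X. \<exists>!S. tilde_spec G V\<^sub>1 V\<^sub>2 W T S) \<and>
        isometric_iso X Y (tilde G V\<^sub>1 V\<^sub>2 W) \<and>
        (\<forall>S\<in>carrier Y. \<exists>!T. hat_spec G V\<^sub>1 \<rho>\<^sub>1 V\<^sub>2 \<rho>\<^sub>2 W S T) \<and>
        hat G V\<^sub>1 \<rho>\<^sub>1 V\<^sub>2 \<rho>\<^sub>2 W \<in> carrier Y \<rightarrow> carrier X \<and>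
        (\<forall>T\<in>carrier X. hat G V\<^sub>1 \<rho>\<^sub>1 V\<^sub>2 \<rho>\<^sub>2 W (tilde G V\<^sub>1 V\<^sub>2 W T) = T) \<and>
        (\<forall>S\<in>carrier Y. tilde G V\<^sub>1 V\<^sub>2 W (hat G V\<^sub>1 \<rho>\<^sub>1 V\<^sub>2 \<rho>\<^sub>2 W S) = S)"
proof -
  interpret triple_reps G H V\<^sub>1 \<rho>\<^sub>1 V\<^sub>2 \<rho>\<^sub>2 W \<theta>
    using assms by (auto simp: triple_reps_def triple_reps_axioms_def irreducible_rep_def)
  show ?thesis
    unfolding Let_def
  proof (intro conjI ballI funcsetI)
    show "\<exists>!S. tilde_spec G V\<^sub>1 V\<^sub>2 W T S" if "T \<in> carrier X" for T
      using that tilde_ex1 by (simp add: in_X_iff)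
    show "\<exists>!T. hat_spec G V\<^sub>1 \<rho>\<^sub>1 V\<^sub>2 \<rho>\<^sub>2 W S T" if "S \<in> carrier Y" for S
      using that hat_ex1 by (simp add: in_Y_iff)
  qed (fact tilde_isometric_iso | erule hat_intertwines hat_tilde tilde_hat)+
qed

end
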